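(* Let $f\in\mathcal{D}'(\mathbb{R}^d)$, $\mathbf{x}_0\in\mathbb{R}^d$, and let $\gamma$ be a constant. Then the following are equivalent: 1. For every standard delta sequence $\{\phi_n\}_{n=1}^\infty$ generated by a positive normalized radial test function of $\mathcal{D}(\mathbb{R}^d)$, $$\lim_{n\to\infty}\langle f(\mathbf{x}_0+\mathbf{x}),\phi_n(\mathbf{x})\rangle=\gamma .$$ 2. The radial distributional point value of $f$ exists at $\mathbf{x}_0$ and equals $\gamma$.
   Context: $\mathcal{D}(\mathbb{R}^d)$ is the space of compactly supported $C^\infty$ functions, $\mathcal{D}'(\mathbb{R}^d)$ its dual (distributions). A test function $\phi$ is positive if $\phi\ge0$ everywhere and normalized if $\int_{\mathbb{R}^d}\phi=1$. The standard delta sequence generated by a normalized $\phi\in\mathcal{D}(\mathbb{R}^d)$ is $\phi_n(\mathbf{x})=n^d\phi(n\mathbf{x})$, $n=1,2,\dots$. Translations and dilations of distributions are defined by change of variables: $\langle f(\mathbf{x}_0+\varepsilon\mathbf{x}),\phi(\mathbf{x})\rangle=|\varepsilon|^{-d}\langle f(\mathbf{y}),\phi((\mathbf{y}-\mathbf{x}_0)/\varepsilon)\rangle$ for $\varepsilon\neq0$. A test function $\phi\in\mathcal{D}(\mathbb{R}^d)$ is radial if $\phi(\mathbf{x})=\varphi(|\mathbf{x}|)$ for some even $\varphi\in\mathcal{D}(\mathbb{R})$. The radial component of $\phi\in\mathcal{D}(\mathbb{R}^d)$ is the radial test function $\widetilde\phi(\mathbf{x})=\phi^o(|\mathbf{x}|)$,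 where $\phi^o(r)=\frac1\omega\int_{\mathbb{S}}\phi(r\theta)\,\mathrm{d}\sigma(\theta)$, $\mathbb{S}$ is the unit sphere of $\mathbb{R}^d$, $\sigma$ its surface measure, and $\omega=2\pi^{d/2}/\Gamma(d/2)$ its total area. The radial component of a distribution $g\in\mathcal{D}'(\mathbb{R}^d)$ is the distribution $\widetilde g$ with $\langle\widetilde g,\phi\rangle=\langle g,\widetilde\phi\rangle$ for all $\phi\in\mathcal{D}(\mathbb{R}^d)$. A distribution $h$ has distributional point value $h(\mathbf{0})=\gamma$ if $\lim_{\varepsilon\to0}\langle h(\varepsilon\mathbf{x}),\phi(\mathbf{x})\rangle=\gamma\int_{\mathbb{R}^d}\phi$ for all $\phi\in\mathcal{D}(\mathbb{R}^d)$. The radial distributional point value of $f$ at $\mathbf{x}_0$ exists and equals $\gamma$ if $\widetilde g(\mathbf{0})=\gamma$ distributionally, where $\widetilde g$ is the radial component of $g(\mathbf{x})=f(\mathbf{x}_0+\mathbf{x})$. *)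

theory Defs
  imports "HOL-Analysis.Analysis"
begin

section \<open>Test functions\<close>

fun iterated_partial ::
  "'a::real_normed_vector list \<Rightarrow> ('a \<Rightarrow> 'b::real_normed_vector) \<Rightarrow> 'a \<Rightarrow> 'b" where
  "iterated_partial [] \<phi> = \<phi>"
| "iterated_partial (v # vs) \<phi> = (\<lambda>x. frechet_derivative (iterated_partial vs \<phi>) (at x) v)"

text \<open>A function is \<open>C\<^sup>\<infinity>\<close> iff all its iterated partial derivatives are differentiable
  everywhere. The value type \<open>complex\<close> of test functions is differentiated as a real vector space.\<close>

definition smooth :: "('a::euclidean_space \<Rightarrow> 'b::real_normed_vector) \<Rightarrow> bool" where
  "smooth \<phi> \<longleftrightarrow> (\<forall>vs \<in> lists Basis. \<forall>x. iterated_partial vs \<phi> differentiable (at x))"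

definition test_function :: "('a::euclidean_space \<Rightarrow> complex) \<Rightarrow> bool" where
  "test_function \<phi> \<longleftrightarrow> smooth \<phi> \<and> compact (closure {x. \<phi> x \<noteq> 0})"

definition positive_fun :: "('a \<Rightarrow> complex) \<Rightarrow> bool" where
  "positive_fun \<phi> \<longleftrightarrow> (\<forall>x. \<phi> x \<in> \<real>\<^sub>\<ge>\<^sub>0)"

definition normalized :: "('a::euclidean_space \<Rightarrow> complex) \<Rightarrow> bool" where
  "normalized \<phi> \<longleftrightarrow> (LINT x|lborel. \<phi> x) = 1"

definition radial :: "('a::euclidean_space \<Rightarrow> complex) \<Rightarrow> bool" where
  "radial \<phi> \<longleftrightarrow>
     (\<exists>\<psi> :: real \<Rightarrow> complex. test_function \<psi> \<and> (\<forall>r. \<psi> (- r) = \<psi> r) \<and> (\<forall>x. \<phi> x = \<psi> (norm x)))"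

definition standard_delta_sequence ::
  "('a::euclidean_space \<Rightarrow> complex) \<Rightarrow> nat \<Rightarrow> 'a \<Rightarrow> complex" where
  "standard_delta_sequence \<phi> n = (\<lambda>x. of_nat n ^ DIM('a) * \<phi> (of_nat n *\<^sub>R x))"


section \<open>Distributions\<close>

text \<open>Convergence of sequences of test functions: supports in a common compact set, and uniform
  convergence of all partial derivatives.\<close>

definition test_function_converges ::
  "(nat \<Rightarrow> 'a::euclidean_space \<Rightarrow> complex) \<Rightarrow> ('a \<Rightarrow> complex) \<Rightarrow> bool" where
  "test_function_converges \<Phi> \<phi> \<longleftrightarrow>
     (\<forall>k. test_function (\<Phi> k)) \<and> test_function \<phi> \<and>
     (\<exists>K. compact K \<and> (\<forall>k. {x. \<Phi> k x \<noteq> 0} \<subseteq> K)) \<and>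
     (\<forall>vs \<in> lists Basis.
        uniform_limit UNIV (\<lambda>k. iterated_partial vs (\<Phi> k)) (iterated_partial vs \<phi>) sequentially)"

text \<open>A distribution is represented by a functional on all functions, of which only the values on
  test functions are meaningful. Continuity on the test function space is sequential
  continuity, which for linear functionals is the same as continuity for its usual
  inductive limit topology.\<close>

definition distribution :: "(('a::euclidean_space \<Rightarrow> complex) \<Rightarrow> complex) \<Rightarrow> bool" where
  "distribution f \<longleftrightarrow>
     (\<forall>\<phi> \<psi>. test_function \<phi> \<longrightarrow> test_function \<psi> \<longrightarrow> f (\<lambda>x. \<phi> x + \<psi> x) = f \<phi> + f \<psi>) \<and>
     (\<forall>c \<phi>. test_function \<phi> \<longrightarrow> f (\<lambda>x. c * \<phi> x) = c * f \<phi>) \<and>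
     (\<forall>\<Phi> \<phi>. test_function_converges \<Phi> \<phi> \<longrightarrow> (\<lambda>k. f (\<Phi> k)) \<longlonglongrightarrow> f \<phi>)"

text \<open>The distribution \<open>f (x0 + \<epsilon> x)\<close> in the variable \<open>x\<close>, for \<open>\<epsilon> \<noteq> 0\<close>.\<close>

definition affine_change ::
  "(('a::euclidean_space \<Rightarrow> complex) \<Rightarrow> complex) \<Rightarrow> 'a \<Rightarrow> real \<Rightarrow> ('a \<Rightarrow> complex) \<Rightarrow> complex" where
  "affine_change f x0 \<epsilon> = (\<lambda>\<phi>. of_real (1 / \<bar>\<epsilon>\<bar> ^ DIM('a)) * f (\<lambda>y. \<phi> ((y - x0) /\<^sub>R \<epsilon>)))"

definition has_point_value_at_0 ::
  "(('a::euclidean_space \<Rightarrow> complex) \<Rightarrow> complex) \<Rightarrow> complex \<Rightarrow> bool" where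
  "has_point_value_at_0 h \<gamma> \<longleftrightarrow>
     (\<forall>\<phi>. test_function \<phi> \<longrightarrow>
        ((\<lambda>\<epsilon>. affine_change h 0 \<epsilon> \<phi>) \<longlongrightarrow> \<gamma> * (LINT x|lborel. \<phi> x)) (at 0))"


section \<open>Radial components\<close>

text \<open>The surface measure of the unit sphere, extended by zero to the whole space: the area of
  \<open>A\<close> is \<open>d\<close> times the volume of the cone \<open>{t \<theta> | 0 < t < 1, \<theta> \<in> A}\<close>. On a nonzero vector,
  \<open>sgn\<close> is the direction \<open>x / |x|\<close>.\<close>

definition sphere_measure :: "'a::euclidean_space measure" where
  "sphere_measure =
     scale_measure (of_nat DIM('a)) (distr (restrict_space lborel (ball 0 1 - {0})) borel sgn)"

definition sphere_area :: "'a::euclidean_space itself \<Rightarrow> real" where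
  "sphere_area _ = 2 * pi powr (real DIM('a) / 2) / Gamma (real DIM('a) / 2)"

lemma sgn_measurable_punctured_ball:
  "sgn \<in> restrict_space lborel (ball 0 1 - {0 :: 'a::euclidean_space}) \<rightarrow>\<^sub>M borel"
proof -
  have "sgn \<in> borel_measurable (borel :: 'a measure)"
    unfolding sgn_div_norm[abs_def] by measurable
  then show ?thesis
    by (intro measurable_restrict_space1) simp
qed

lemma emeasure_sphere_measure:
  fixes A :: "'a::euclidean_space set"
  assumes "A \<in> sets borel"
  shows "emeasure sphere_measure A =
    of_nat DIM('a) * emeasure lborel {x \<in> ball 0 1. x \<noteq> 0 \<and> sgn x \<in> A}"
proof -
  have "sgn -` A \<inter> space (restrict_space lborel (ball 0 1 - {0})) =
      {x \<in> ball 0 1. x \<noteq> 0 \<and> sgn x \<in> A}"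
    by (auto simp: space_restrict_space)
  moreover have "{x \<in> ball 0 1. x \<noteq> 0 \<and> sgn x \<in> A} \<subseteq> ball 0 1 - {0}"
    by auto
  ultimately show ?thesis
    using assms sgn_measurable_punctured_ball[where 'a='a]
    by (simp add: sphere_measure_def emeasure_distr emeasure_restrict_space)
qed

lemma emeasure_sphere_measure_sphere:
  "emeasure sphere_measure (sphere 0 1 :: 'a::euclidean_space set) = sphere_area TYPE('a)"
proof -
  have eq: "{x \<in> ball 0 1. x \<noteq> 0 \<and> sgn x \<in> sphere 0 1} = ball (0::'a) 1 - {0}"
    by (auto simp: norm_sgn)
  have "emeasure lborel (ball (0::'a) 1 - {0}) = emeasure lborel (ball (0::'a) 1)"
    by (subst emeasure_Diff) auto
  also have "\<dots> = ennreal (unit_ball_vol (real DIM('a)))"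
    by (subst emeasure_ball) auto
  finally have "emeasure sphere_measure (sphere 0 1 :: 'a set) =
      of_nat DIM('a) * ennreal (unit_ball_vol (real DIM('a)))"
    by (subst emeasure_sphere_measure, simp, simp only: eq)
  also have "\<dots> = ennreal (real DIM('a) * unit_ball_vol (real DIM('a)))"
    by (simp add: ennreal_mult ennreal_of_nat_eq_real_of_nat)
  also have "real DIM('a) * unit_ball_vol (real DIM('a)) = sphere_area TYPE('a)"
  proof -
    have "real DIM('a) / 2 > 0" by simp
    then have *: "Gamma (real DIM('a) / 2 + 1) = real DIM('a) / 2 * Gamma (real DIM('a) / 2)"
      by (intro Gamma_plus1) auto
    show ?thesis
      unfolding unit_ball_vol_def sphere_area_def * by simp
  qed
  finally show ?thesis .
qed

definition spherical_mean :: "('a::euclidean_space \<Rightarrow> complex) \<Rightarrow> real \<Rightarrow> complex" where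
  "spherical_mean \<phi> r =
     of_real (1 / sphere_area TYPE('a)) * (LINT \<theta>|sphere_measure. \<phi> (r *\<^sub>R \<theta>))"

definition radial_component_fun :: "('a::euclidean_space \<Rightarrow> complex) \<Rightarrow> 'a \<Rightarrow> complex" where
  "radial_component_fun \<phi> = (\<lambda>x. spherical_mean \<phi> (norm x))"

definition radial_component ::
  "(('a::euclidean_space \<Rightarrow> complex) \<Rightarrow> complex) \<Rightarrow> ('a \<Rightarrow> complex) \<Rightarrow> complex" where
  "radial_component g = (\<lambda>\<phi>. g (radial_component_fun \<phi>))"

definition has_radial_point_value ::
  "(('a::euclidean_space \<Rightarrow> complex) \<Rightarrow> complex) \<Rightarrow> 'a \<Rightarrow> complex \<Rightarrow> bool" where
  "has_radial_point_value f x0 \<gamma> \<longleftrightarrow>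
     has_point_value_at_0 (radial_component (affine_change f x0 1)) \<gamma>"

end

theory Submission
  imports Defs
begin

text \<open>
  For a test function \<open>\<phi>\<close> put \<open>G \<phi> t = t\<^sup>d f (\<phi> (t (y - x0)))\<close>. Replacing \<open>\<phi>\<close> by its radial component
  \<open>\<Phi>\<close>, which has the same integral by polar coordinates, the radial point value condition says
  that \<open>G \<Phi> t\<close> tends to \<open>\<gamma> \<integral>\<Phi>\<close> as the real variable \<open>t = 1 / \<bar>\<epsilon>\<bar>\<close> tends to infinity, while the
  hypothesis on delta sequences only controls \<open>G \<phi> n\<close> for integers \<open>n\<close> and positive normalized radial
  \<open>\<phi>\<close>. Applied to all dilates of \<open>\<phi>\<close> it gives \<open>G \<phi> (n s) \<rightarrow> \<gamma>\<close> for every \<open>s > 0\<close>; as \<open>G \<phi>\<close> is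
  continuous, Croft's lemma (a Baire category argument) yields \<open>G \<phi> t \<rightarrow> \<gamma>\<close>. Adding a large multiple
  of a radial bump makes any real radial test function positive, so linearity extends the limit to
  all radial test functions.

  The radial component is smooth because its profile, the spherical mean, is smooth and even, and
  for an even smooth profile \<open>\<psi>\<close> the function \<open>\<psi>' r / r = \<integral>\<^sub>0\<^sup>1 \<psi>'' (t r) dt\<close> is again even and smooth,
  so that the gradient \<open>x \<psi>' \<bar>x\<bar> / \<bar>x\<bar>\<close> of \<open>\<psi> \<bar>x\<bar>\<close> has the same shape.
\<close>

section \<open>Limits along multiples\<close>

text \<open>\<open>x / n\<close> lies in the interval exactly when \<open>n\<close> lies between
  \<open>x / b\<close> and \<open>x / a\<close>. That range is longer than 1 once \<open>x\<close>
  exceeds \<open>1 / (1 / a - 1 / b)\<close>, so it contains an integer, and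
  \<open>b * N < x\<close> puts its left end beyond \<open>N\<close>.\<close>

lemma exists_multiple_in_interval:
  fixes a b x :: real and N :: nat
  assumes "0 < a" "a < b" "b * real N < x" "1 / (1 / a - 1 / b) < x"
  shows "\<exists>n\<ge>N. 0 < n \<and> x / real n \<in> {a<..<b}"
proof -
  have b: "0 < b" and x: "0 < x"
    using assms by (auto intro: le_less_trans[of 0 "b * real N" x])
  \<comment> \<open>The least integer strictly above \<open>x / b\<close>; it overshoots by at most
    1.\<close>
  define n where "n = Suc (nat \<lfloor>x / b\<rfloor>)"
  have n1: "x / b < real n"
    unfolding n_def using b x by (simp add: nat_floor_neg) linarith
  have "0 \<le> x / b" using b x by simp
  then have n2: "real n \<le> x / b + 1"
    unfolding n_def by (simp add: of_nat_floor)
  have "0 < 1 / a - 1 / b"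
    using assms by (simp add: field_simps)
  then have "1 < x * (1 / a - 1 / b)"
    using assms(4) by (simp add: pos_divide_less_eq)
  then have n3: "real n < x / a"
    using n2 by (simp add: algebra_simps)
  have "real N < x / b"
    using assms(3) b by (simp add: field_simps)
  then have "N \<le> n" using n1 by linarith
  moreover have "x / real n \<in> {a<..<b}"
    using n1 n3 b assms(1) n_def by (simp add: field_simps)
  ultimately show ?thesis
    unfolding n_def by blast
qed

text \<open>Croft's lemma. The convergence is pointwise in \<open>s\<close>; Baire category makes it
  uniform on some interval, and every large \<open>x\<close> is a large multiple of a point of that
  interval.\<close>

lemma tendsto_at_top_if_tendsto_multiples:
  fixes G :: "real \<Rightarrow> 'a::real_normed_vector"
  assumes cont: "continuous_on {0<..} G"
    and lim: "\<And>s. 0 < s \<Longrightarrow> (\<lambda>n. G (real n * s)) \<longlonglongrightarrow> c"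
  shows "(G \<longlongrightarrow> c) at_top"
proof (rule tendstoI)
  fix e :: real assume "0 < e"
  \<comment> \<open>The non-strict bound makes each \<open>F N\<close> closed, and
    \<open>0 < n\<close> keeps \<open>n * s\<close> in the half-line where \<open>G\<close> is
    continuous.\<close>
  define F where "F N = {s \<in> {1..2}. \<forall>n\<ge>N. 0 < n \<longrightarrow> dist (G (real n * s)) c \<le> e / 2}" for N
  have clF: "closed (F N)" for N
  proof -
    have "closed {s \<in> {1..2}. dist (G (real n * s)) c \<le> e / 2}" if "0 < n" for n
    proof -
      have "continuous_on {1..2} (\<lambda>s. dist (G (real n * s)) c)"
        using that by (intro continuous_intros continuous_on_compose2[OF cont]) auto
      then show ?thesis
        by (intro continuous_on_closed_Collect_le) (auto intro: continuous_intros)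
    qed
    then have "closed ({1..2} \<inter> (\<Inter>n\<in>{n. N \<le> n \<and> 0 < n}. {s \<in> {1..2}. dist (G (real n * s)) c \<le> e / 2}))"
      by (intro closed_Int closed_INT) auto
    moreover have "F N = {1..2} \<inter> (\<Inter>n\<in>{n. N \<le> n \<and> 0 < n}. {s \<in> {1..2}. dist (G (real n * s)) c \<le> e / 2})"
      unfolding F_def by auto
    ultimately show ?thesis by simp
  qed
  have un: "(\<Union>N. F N) = {1..2}"
  proof -
    have "s \<in> (\<Union>N. F N)" if "s \<in> {1..2}" for s
    proof -
      have "eventually (\<lambda>n. dist (G (real n * s)) c < e / 2) sequentially"
        using lim[of s] that \<open>0 < e\<close> by (intro tendstoD) auto
      then obtain N where "\<And>n. n \<ge> N \<Longrightarrow> dist (G (real n * s)) c < e / 2"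
        by (auto simp: eventually_sequentially)
      then have "s \<in> F N"
        unfolding F_def using that by (auto intro: less_imp_le)
      then show ?thesis by blast
    qed
    then show ?thesis unfolding F_def by auto
  qed
  \<comment> \<open>Countably many closed sets without interior points cannot cover
    \<open>{1..2}\<close>.\<close>
  have "\<exists>N. interior (F N) \<noteq> {}"
  proof (rule ccontr)
    assume "\<not> (\<exists>N. interior (F N) \<noteq> {})"
    then have "euclidean interior_of \<Union>(range F) = {}"
      using clF
      by (intro Baire_category_alt)
        (auto simp: completely_metrizable_space_euclidean)
    then have "interior {1..2::real} = {}"
      using un by simp
    then show False by simp
  qed
  then obtain N s0 where "s0 \<in> interior (F N)" by blast
  then obtain d where d: "0 < d" "ball s0 d \<subseteq> F N"
    by (meson mem_interior)
  \<comment> \<open>Only the right half of the ball is used: its left end is the centre, which is at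
    least 1 as a point of \<open>F N\<close>.\<close>
  define a b where "a = s0" and "b = s0 + d"
  have "s0 \<in> F N" using d by auto
  then have "0 < a" "a < b" unfolding a_def b_def F_def using d by auto
  have ab: "{a<..<b} \<subseteq> F N"
    using d(2) unfolding a_def b_def by (auto simp: ball_def dist_real_def)
  have "eventually (\<lambda>x. max (b * real N) (1 / (1 / a - 1 / b)) < x) at_top"
    by (rule eventually_gt_at_top)
  then show "eventually (\<lambda>x. dist (G x) c < e) at_top"
  proof eventually_elim
    case (elim x)
    then obtain n where n: "n \<ge> N" "0 < n" "x / real n \<in> {a<..<b}"
      using exists_multiple_in_interval[OF \<open>0 < a\<close> \<open>a < b\<close>, of N x] by auto
    then have "dist (G (real n * (x / real n))) c \<le> e / 2"
      using ab unfolding F_def by blast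
    then show ?case using n \<open>0 < e\<close> by simp
  qed
qed

section \<open>Smooth functions and test functions\<close>

lemma iterated_partial_append:
  "iterated_partial (us @ vs) \<phi> = iterated_partial us (iterated_partial vs \<phi>)"
  by (induction us) auto

text \<open>Induction on the list of directions keeps every iterated partial derivative of
  \<open>g\<close> inside \<open>S\<close>, whose members are differentiable. Smoothness proofs thus
  reduce to exhibiting a class closed under partial differentiation.\<close>

lemma smooth_coinduct:
  assumes "g \<in> S"
    and S: "\<And>g. g \<in> S \<Longrightarrow> \<exists>g'. (\<forall>x. (g has_derivative g' x) (at x)) \<and> (\<forall>v\<in>Basis. (\<lambda>x. g' x v) \<in> S)"
  shows "smooth g"
proof -
  have "iterated_partial vs g \<in> S" if "vs \<in> lists Basis" for vs
    using that
  proof (induction vs)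
    case (Cons v vs)
    then obtain g' where g': "\<And>x. (iterated_partial vs g has_derivative g' x) (at x)"
      "\<And>v. v \<in> Basis \<Longrightarrow> (\<lambda>x. g' x v) \<in> S"
      using S[of "iterated_partial vs g"] by auto
    then have "iterated_partial (v # vs) g = (\<lambda>x. g' x v)"
      by (simp add: frechet_derivative_at[OF g'(1), symmetric])
    then show ?case using g'(2) Cons by auto
  qed (use assms in simp)
  then show ?thesis
    unfolding smooth_def using S by (meson differentiable_def)
qed

lemma smooth_differentiable: "smooth \<phi> \<Longrightarrow> \<phi> differentiable (at x)"
  unfolding smooth_def by (metis iterated_partial.simps(1) lists.Nil)

lemma smooth_has_derivative:
  "smooth \<phi> \<Longrightarrow> (\<phi> has_derivative frechet_derivative \<phi> (at x)) (at x)"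
  using frechet_derivative_works smooth_differentiable by blast

lemma smooth_continuous_on: "smooth \<phi> \<Longrightarrow> continuous_on A \<phi>"
  by (meson smooth_differentiable continuous_at_imp_continuous_on differentiable_imp_continuous_within)

lemma smooth_iterated_partial:
  assumes "smooth \<phi>" "vs \<in> lists Basis"
  shows "smooth (iterated_partial vs \<phi>)"
  unfolding smooth_def
proof (intro ballI allI)
  fix us :: "'a list" and x assume "us \<in> lists Basis"
  then have "us @ vs \<in> lists Basis" using assms by simp
  then show "iterated_partial us (iterated_partial vs \<phi>) differentiable at x"
    using assms unfolding smooth_def by (metis iterated_partial_append)
qed

lemma smooth_partial:
  "smooth \<phi> \<Longrightarrow> v \<in> Basis \<Longrightarrow> smooth (\<lambda>x. frechet_derivative \<phi> (at x) v)"
  using smooth_iterated_partial[of \<phi> "[v]"] by simp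

lemma smooth_add:
  assumes "smooth \<phi>" "smooth \<psi>"
  shows "smooth (\<lambda>x. \<phi> x + \<psi> x)"
proof (rule smooth_coinduct[where S = "{\<lambda>x. \<phi> x + \<psi> x |\<phi> \<psi>. smooth \<phi> \<and> smooth \<psi>}"])
  fix g assume "g \<in> {\<lambda>x. \<phi> x + \<psi> x |\<phi> \<psi>. smooth (\<phi> :: 'a \<Rightarrow> 'b) \<and> smooth \<psi>}"
  then obtain \<phi> \<psi> where g: "g = (\<lambda>x. \<phi> x + \<psi> x)" and *: "smooth (\<phi> :: 'a \<Rightarrow> 'b)" "smooth \<psi>" by blast
  show "\<exists>g'. (\<forall>x. (g has_derivative g' x) (at x)) \<and>
      (\<forall>v\<in>Basis. (\<lambda>x. g' x v) \<in> {\<lambda>x. \<phi> x + \<psi> x |\<phi> \<psi>. smooth \<phi> \<and> smooth \<psi>})"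
  proof (intro exI conjI allI ballI)
    fix x show "(g has_derivative (\<lambda>v. frechet_derivative \<phi> (at x) v + frechet_derivative \<psi> (at x) v)) (at x)"
      unfolding g using * by (intro has_derivative_add smooth_has_derivative)
  next
    fix v :: 'a assume "v \<in> Basis"
    then show "(\<lambda>x. frechet_derivative \<phi> (at x) v + frechet_derivative \<psi> (at x) v)
        \<in> {\<lambda>x. \<phi> x + \<psi> x |\<phi> \<psi>. smooth \<phi> \<and> smooth \<psi>}"
      using *[THEN smooth_partial]
      by (intro CollectI exI conjI) (rule refl)
  qed
qed (use assms in blast)

lemma smooth_bounded_linear:
  assumes "smooth \<phi>" "bounded_linear L"
  shows "smooth (\<lambda>x. L (\<phi> x))"
proof (rule smooth_coinduct[where S = "{\<lambda>x. L (\<phi> x) |\<phi>. smooth \<phi>}"])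
  fix g assume "g \<in> {\<lambda>x. L (\<phi> x) |\<phi>. smooth (\<phi> :: 'a \<Rightarrow> 'b)}"
  then obtain \<phi> where g: "g = (\<lambda>x. L (\<phi> x))" and *: "smooth (\<phi> :: 'a \<Rightarrow> 'b)" by blast
  show "\<exists>g'. (\<forall>x. (g has_derivative g' x) (at x)) \<and>
      (\<forall>v\<in>Basis. (\<lambda>x. g' x v) \<in> {\<lambda>x. L (\<phi> x) |\<phi>. smooth \<phi>})"
  proof (intro exI conjI allI ballI)
    fix x show "(g has_derivative (\<lambda>v. L (frechet_derivative \<phi> (at x) v))) (at x)"
      unfolding g by (rule bounded_linear.has_derivative[OF assms(2) smooth_has_derivative[OF *]])
  next
    fix v :: 'a assume "v \<in> Basis"
    then show "(\<lambda>x. L (frechet_derivative \<phi> (at x) v)) \<in> {\<lambda>x. L (\<phi> x) |\<phi>. smooth \<phi>}"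
      using smooth_partial[OF *] by (intro CollectI exI conjI) (rule refl)
  qed
qed (use assms in blast)

text \<open>Each differentiation brings out one factor \<open>s\<close> by the chain rule. The
  explicit form yields smoothness of dilates and later the uniform convergence of all their
  derivatives.\<close>

lemma iterated_partial_dilation:
  assumes "smooth \<phi>" "vs \<in> lists Basis"
  shows "iterated_partial vs (\<lambda>y. \<phi> (s *\<^sub>R (y - a))) =
      (\<lambda>y. s ^ length vs *\<^sub>R iterated_partial vs \<phi> (s *\<^sub>R (y - a)))"
  using assms(2)
proof (induction vs)
  case (Cons v vs)
  let ?\<chi> = "iterated_partial vs \<phi>"
  let ?D = "\<lambda>y. frechet_derivative ?\<chi> (at (s *\<^sub>R (y - a)))"
  have sm: "smooth ?\<chi>" using assms Cons.hyps smooth_iterated_partial by blast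
  have der: "((\<lambda>y. s ^ length vs *\<^sub>R ?\<chi> (s *\<^sub>R (y - a))) has_derivative
      (\<lambda>h. s ^ length vs *\<^sub>R ?D y (s *\<^sub>R h))) (at y)" for y
  proof -
    have "((\<lambda>y. s *\<^sub>R (y - a)) has_derivative (\<lambda>h. s *\<^sub>R h)) (at y)"
      by (auto intro!: derivative_eq_intros)
    from has_derivative_compose[OF this smooth_has_derivative[OF sm]]
    show ?thesis by (rule has_derivative_scaleR_right)
  qed
  have lin: "?D y (s *\<^sub>R v) = s *\<^sub>R ?D y v" for y
    using smooth_has_derivative[OF sm] by (meson has_derivative_linear linear_scale)
  show ?case
    using Cons
    by (simp add: frechet_derivative_at[OF der, symmetric] lin mult.commute)
qed simp

lemma smooth_dilation:
  assumes "smooth \<phi>"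
  shows "smooth (\<lambda>y. \<phi> (s *\<^sub>R (y - a)))"
  unfolding smooth_def
proof (intro ballI allI)
  fix vs :: "'a list" and x assume vs: "vs \<in> lists Basis"
  have "(iterated_partial vs \<phi>) differentiable (at (s *\<^sub>R (x - a)))"
    using assms vs unfolding smooth_def by blast
  then have "(\<lambda>y. iterated_partial vs \<phi> (s *\<^sub>R (y - a))) differentiable (at x)"
    using differentiable_chain_at[of "\<lambda>y. s *\<^sub>R (y - a)" x "iterated_partial vs \<phi>"]
    by (simp add: o_def)
  then show "iterated_partial vs (\<lambda>y. \<phi> (s *\<^sub>R (y - a))) differentiable at x"
    unfolding iterated_partial_dilation[OF assms vs] by (intro derivative_intros)
qed

section \<open>Compactly supported smooth functions\<close>

lemma test_functionI:
  assumes "smooth \<phi>" "\<And>x. R < norm x \<Longrightarrow> \<phi> x = 0"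
  shows "test_function \<phi>"
proof -
  have "{x. \<phi> x \<noteq> 0} \<subseteq> cball 0 R"
    using assms(2) by (force simp: not_less[symmetric])
  then have "bounded {x. \<phi> x \<noteq> 0}" by (rule bounded_subset[OF bounded_cball])
  then show ?thesis unfolding test_function_def using assms(1) by simp
qed

lemma test_functionE:
  assumes "test_function \<phi>"
  obtains R where "0 < R" "\<And>x. R < norm x \<Longrightarrow> \<phi> x = 0"
proof -
  have "bounded {x. \<phi> x \<noteq> 0}"
    using assms unfolding test_function_def
    by (meson bounded_subset closure_subset compact_imp_bounded)
  then obtain R where "0 < R" "\<And>x. \<phi> x \<noteq> 0 \<Longrightarrow> norm x \<le> R"
    by (auto simp: bounded_pos)
  then show ?thesis using that by force
qed

lemma test_function_smooth: "test_function \<phi> \<Longrightarrow> smooth \<phi>"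
  by (simp add: test_function_def)

lemma test_function_partial:
  assumes "test_function \<phi>" "v \<in> Basis"
  shows "test_function (\<lambda>x. frechet_derivative \<phi> (at x) v)"
proof -
  obtain R where R: "\<And>x. R < norm x \<Longrightarrow> \<phi> x = 0" using test_functionE[OF assms(1)] by blast
  have "frechet_derivative \<phi> (at x) v = 0" if "R < norm x" for x
  proof -
    have "open {x::'a. R < norm x}" by (intro open_Collect_less continuous_intros)
    then have "(\<phi> has_derivative (\<lambda>_. 0)) (at x)"
      using that R by (auto intro: has_derivative_transform_within_open[OF has_derivative_const])
    then show ?thesis by (metis frechet_derivative_at)
  qed
  then show ?thesis
    using smooth_partial[OF test_function_smooth[OF assms(1)] assms(2)]
    by (intro test_functionI[of _ R]) blast+
qed

lemma test_function_iterated_partial: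
  assumes "test_function \<phi>" "vs \<in> lists Basis"
  shows "test_function (iterated_partial vs \<phi>)"
  using assms(2) by (induction vs) (auto simp: assms(1) test_function_partial)

lemma test_function_bounded:
  assumes "test_function \<phi>"
  obtains B where "0 < B" "\<And>x. norm (\<phi> x) \<le> B"
proof -
  obtain R where R: "0 < R" "\<And>x. R < norm x \<Longrightarrow> \<phi> x = 0" using test_functionE[OF assms] by blast
  have "compact (\<phi> ` cball 0 R)"
    using assms by (intro compact_continuous_image smooth_continuous_on test_function_smooth) auto
  then obtain B where "0 < B" "\<And>x. x \<in> cball 0 R \<Longrightarrow> norm (\<phi> x) \<le> B"
    by (auto dest!: compact_imp_bounded simp: bounded_pos)
  then have "norm (\<phi> x) \<le> B" for x using R by (cases "norm x \<le> R") auto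
  then show ?thesis using \<open>0 < B\<close> that by blast
qed

text \<open>The partial derivatives are bounded, being test functions; the sum of their bounds
  bounds the operator norm of the derivative, and the mean value inequality applies.\<close>

lemma test_function_lipschitz:
  assumes "test_function \<phi>"
  obtains L where "0 < L" "\<And>x y. norm (\<phi> x - \<phi> y) \<le> L * norm (x - y)"
proof -
  let ?D = "\<lambda>x. frechet_derivative \<phi> (at x)"
  have "\<forall>v\<in>Basis. \<exists>B>0. \<forall>x. norm (?D x v) \<le> B"
  proof
    fix v :: 'a assume "v \<in> Basis"
    then show "\<exists>B>0. \<forall>x. norm (?D x v) \<le> B"
      using test_function_bounded[OF test_function_partial[OF assms]] by blast
  qed
  then obtain B where B: "\<And>v x. v \<in> Basis \<Longrightarrow> norm (?D x v) \<le> B v" "\<And>v. v \<in> Basis \<Longrightarrow> 0 < B v"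
    by metis
  define L where "L = sum B Basis"
  have "0 < L" unfolding L_def using B(2) by (intro sum_pos) auto
  have der: "(\<phi> has_derivative ?D x) (at x)" for x
    using assms smooth_has_derivative test_function_smooth by blast
  have "onorm (?D x) \<le> L" for x
  proof (rule onorm_bound)
    fix h :: 'a
    have lin: "linear (?D x)" using der has_derivative_linear by blast
    have "?D x h = ?D x (\<Sum>v\<in>Basis. (h \<bullet> v) *\<^sub>R v)" by (simp add: euclidean_representation)
    also have "\<dots> = (\<Sum>v\<in>Basis. (h \<bullet> v) *\<^sub>R ?D x v)"
      by (simp add: linear_sum[OF lin] linear_scale[OF lin])
    also have "norm \<dots> \<le> (\<Sum>v\<in>Basis. norm h * B v)"
      using B by (intro order.trans[OF norm_sum] sum_mono) (auto intro!: mult_mono simp: Basis_le_norm)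
    finally show "norm (?D x h) \<le> L * norm h"
      unfolding L_def by (subst mult.commute) (simp only: sum_distrib_left)
  qed (use \<open>0 < L\<close> in simp)
  then have "norm (\<phi> x - \<phi> y) \<le> L * norm (x - y)" for x y
    using der by (intro differentiable_bound[of UNIV \<phi> ?D]) auto
  then show ?thesis using \<open>0 < L\<close> that by blast
qed

lemma test_function_add:
  assumes "test_function \<phi>" "test_function \<psi>"
  shows "test_function (\<lambda>x. \<phi> x + \<psi> x)"
proof -
  obtain R where R: "\<And>x. R < norm x \<Longrightarrow> \<phi> x = 0" using test_functionE[OF assms(1)] by blast
  obtain Q where Q: "\<And>x. Q < norm x \<Longrightarrow> \<psi> x = 0" using test_functionE[OF assms(2)] by blast
  show ?thesis
    by (rule test_functionI[of _ "max R Q"])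
      (use assms R Q in \<open>auto intro: smooth_add test_function_smooth\<close>)
qed

lemma test_function_bounded_linear:
  assumes "test_function \<phi>" "bounded_linear L"
  shows "test_function (\<lambda>x. L (\<phi> x))"
proof -
  obtain R where R: "\<And>x. R < norm x \<Longrightarrow> \<phi> x = 0" using test_functionE[OF assms(1)] by blast
  show ?thesis
  proof (rule test_functionI[of _ R])
    show "smooth (\<lambda>x. L (\<phi> x))"
      by (rule smooth_bounded_linear[OF test_function_smooth[OF assms(1)] assms(2)])
  qed (use assms R in \<open>simp add: linear_0 bounded_linear.linear\<close>)
qed

lemma test_function_cmult: "test_function \<phi> \<Longrightarrow> test_function (\<lambda>x. c * \<phi> x)"
  by (rule test_function_bounded_linear[OF _ bounded_linear_mult_right])

lemma test_function_dilation:
  assumes "test_function \<phi>" "s \<noteq> 0"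
  shows "test_function (\<lambda>y. \<phi> (s *\<^sub>R (y - a)))"
proof -
  obtain R where R: "\<And>x. R < norm x \<Longrightarrow> \<phi> x = 0" using test_functionE[OF assms(1)] by blast
  have "\<phi> (s *\<^sub>R (y - a)) = 0" if "R / \<bar>s\<bar> + norm a < norm y" for y
  proof (rule R)
    have "R / \<bar>s\<bar> < norm (y - a)" using that norm_triangle_ineq2[of y a] by simp
    then show "R < norm (s *\<^sub>R (y - a))" using assms(2)
      by (simp add: pos_divide_less_eq mult.commute)
  qed
  then show ?thesis
    using smooth_dilation[OF test_function_smooth[OF assms(1)]]
    by (intro test_functionI[of _ "R / \<bar>s\<bar> + norm a"]) blast+
qed

lemma test_function_integrable:
  fixes \<phi> :: "'a::euclidean_space \<Rightarrow> complex"
  assumes "test_function \<phi>"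
  shows "integrable lborel \<phi>"
proof -
  obtain R where R: "\<And>x. R < norm x \<Longrightarrow> \<phi> x = 0" using test_functionE[OF assms] by blast
  have "integrable lborel (\<lambda>x. indicator (cball 0 R) x *\<^sub>R \<phi> x)"
    using assms
    by (intro borel_integrable_compact compact_cball smooth_continuous_on test_function_smooth)
  moreover have "(\<lambda>x. indicator (cball 0 R) x *\<^sub>R \<phi> x) = \<phi>"
    using R by (force simp: indicator_def)
  ultimately show ?thesis by simp
qed

lemma test_function_borel_measurable:
  "test_function \<phi> \<Longrightarrow> \<phi> \<in> borel_measurable borel"
  by (intro borel_measurable_continuous_onI smooth_continuous_on test_function_smooth)

section \<open>Dilations of a distribution\<close>

text \<open>Since \<open>t0\<close> is positive, the numbers \<open>1 / t k\<close> are bounded, so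
  all dilates are supported in one ball around \<open>a\<close>. Uniform convergence of the
  derivatives follows from boundedness and Lipschitz continuity of the iterated partial derivatives
  of \<open>\<phi>\<close>.\<close>

lemma test_function_converges_dilation:
  assumes \<phi>: "test_function \<phi>" and t: "\<And>k. 0 < t k" "0 < t0" "t \<longlonglongrightarrow> t0"
  shows "test_function_converges (\<lambda>k y. \<phi> (t k *\<^sub>R (y - a))) (\<lambda>y. \<phi> (t0 *\<^sub>R (y - a)))"
proof -
  have "(\<lambda>k. 1 / t k) \<longlonglongrightarrow> 1 / t0"
    using t by (intro tendsto_intros) auto
  then have "Bseq (\<lambda>k. 1 / t k)" by (rule convergent_imp_Bseq[OF convergentI])
  \<comment> \<open>\<open>K\<close> bounds every \<open>1 / t k\<close> and hence
    \<open>1 / t0\<close>, so for a function supported in radius \<open>R\<close> all these dilates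
    live within radius \<open>R * K\<close>.\<close>
  then obtain K where K: "0 < K" "\<And>k. 1 / t k \<le> K"
    using t(1) by (auto simp: Bseq_def abs_of_pos)
  have K0: "1 / t0 \<le> K"
    by (rule LIMSEQ_le_const2[OF \<open>(\<lambda>k. 1 / t k) \<longlonglongrightarrow> 1 / t0\<close>]) (use K in blast)
  have out: "R < norm (s *\<^sub>R z)" if "R * K < norm z" "0 < R" "1 / s \<le> K" "0 < s" for R s and z :: 'a
  proof -
    have "R * (1 / s) \<le> R * K" using that by (intro mult_left_mono) auto
    then have "R / s < norm z" using that by simp
    then show ?thesis using that by (simp add: pos_divide_less_eq mult.commute)
  qed
  show ?thesis
    unfolding test_function_converges_def
  proof (intro conjI allI ballI)
    show "test_function (\<lambda>y. \<phi> (t k *\<^sub>R (y - a)))" for k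
      using \<phi> t(1)[of k] by (intro test_function_dilation) auto
    show "test_function (\<lambda>y. \<phi> (t0 *\<^sub>R (y - a)))"
      using \<phi> t(2) by (intro test_function_dilation) auto
    obtain R where R: "0 < R" "\<And>x. R < norm x \<Longrightarrow> \<phi> x = 0" using test_functionE[OF \<phi>] by blast
    show "\<exists>C. compact C \<and> (\<forall>k. {x. \<phi> (t k *\<^sub>R (x - a)) \<noteq> 0} \<subseteq> C)"
    proof (intro exI[of _ "cball a (R * K)"] conjI allI subsetI)
      fix k x assume "x \<in> {x. \<phi> (t k *\<^sub>R (x - a)) \<noteq> 0}"
      then have "\<not> R * K < norm (x - a)"
        using R out[of R "x - a" "t k"] K(2)[of k] t(1)[of k] by blast
      then show "x \<in> cball a (R * K)" by (simp add: dist_norm norm_minus_commute)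
    qed simp
  next
    fix vs :: "'a list" assume vs: "vs \<in> lists Basis"
    let ?\<chi> = "iterated_partial vs \<phi>" and ?m = "length vs"
    have \<chi>: "test_function ?\<chi>" using \<phi> vs by (rule test_function_iterated_partial)
    obtain R where R: "0 < R" "\<And>x. R < norm x \<Longrightarrow> ?\<chi> x = 0" using test_functionE[OF \<chi>] by blast
    obtain B where B: "0 < B" "\<And>x. norm (?\<chi> x) \<le> B" using test_function_bounded[OF \<chi>] by blast
    obtain L where L: "0 < L" "\<And>x y. norm (?\<chi> x - ?\<chi> y) \<le> L * norm (x - y)"
      using test_function_lipschitz[OF \<chi>] by blast
    \<comment> \<open>The first summand bounds the change of the outer factor, the second the change
      of the argument. In the latter only \<open>norm z \<le> R * K\<close> matters, since both
      values vanish beyond.\<close>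
    define E where "E k = \<bar>t k ^ ?m - t0 ^ ?m\<bar> * B + t0 ^ ?m * (L * (\<bar>t k - t0\<bar> * (R * K)))" for k
    have "E \<longlonglongrightarrow> \<bar>t0 ^ ?m - t0 ^ ?m\<bar> * B + t0 ^ ?m * (L * (\<bar>t0 - t0\<bar> * (R * K)))"
      unfolding E_def by (intro tendsto_intros t)
    then have E0: "E \<longlonglongrightarrow> 0" by simp
    have bound: "norm (t k ^ ?m *\<^sub>R ?\<chi> (t k *\<^sub>R z) - t0 ^ ?m *\<^sub>R ?\<chi> (t0 *\<^sub>R z)) \<le> E k" for k z
    proof -
      have 1: "norm (?\<chi> (t k *\<^sub>R z) - ?\<chi> (t0 *\<^sub>R z)) \<le> L * (\<bar>t k - t0\<bar> * (R * K))"
      proof (cases "R * K < norm z")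
        case True
        then have "?\<chi> (t k *\<^sub>R z) = 0" "?\<chi> (t0 *\<^sub>R z) = 0"
          using R t K K0 out by blast+
        then show ?thesis using L(1) R(1) K(1) by simp
      next
        case False
        have "norm (?\<chi> (t k *\<^sub>R z) - ?\<chi> (t0 *\<^sub>R z)) \<le> L * norm (t k *\<^sub>R z - t0 *\<^sub>R z)"
          by (rule L)
        also have "\<dots> = L * (\<bar>t k - t0\<bar> * norm z)"
          by (simp add: scaleR_left_diff_distrib[symmetric])
        also have "\<dots> \<le> L * (\<bar>t k - t0\<bar> * (R * K))"
          using False L(1) by (intro mult_left_mono) auto
        finally show ?thesis .
      qed
      have "t k ^ ?m *\<^sub>R ?\<chi> (t k *\<^sub>R z) - t0 ^ ?m *\<^sub>R ?\<chi> (t0 *\<^sub>R z) =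
          (t k ^ ?m - t0 ^ ?m) *\<^sub>R ?\<chi> (t k *\<^sub>R z) + t0 ^ ?m *\<^sub>R (?\<chi> (t k *\<^sub>R z) - ?\<chi> (t0 *\<^sub>R z))"
        by (simp add: algebra_simps)
      also have "norm \<dots> \<le> E k"
        unfolding E_def using B 1 t(2)
        by (intro norm_triangle_le add_mono) (auto intro!: mult_left_mono)
      finally show ?thesis .
    qed
    show "uniform_limit UNIV (\<lambda>k. iterated_partial vs (\<lambda>y. \<phi> (t k *\<^sub>R (y - a))))
        (iterated_partial vs (\<lambda>y. \<phi> (t0 *\<^sub>R (y - a)))) sequentially"
    proof (rule uniform_limitI)
      fix e :: real assume "0 < e"
      then have "eventually (\<lambda>k. E k < e) sequentially"
        using E0 by (rule order_tendstoD(2)[rotated])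
      then show "\<forall>\<^sub>F k in sequentially. \<forall>y\<in>UNIV.
          dist (iterated_partial vs (\<lambda>y. \<phi> (t k *\<^sub>R (y - a))) y)
            (iterated_partial vs (\<lambda>y. \<phi> (t0 *\<^sub>R (y - a))) y) < e"
        unfolding iterated_partial_dilation[OF test_function_smooth[OF \<phi>] vs] dist_norm
        by eventually_elim (use bound le_less_trans in blast)
    qed
  qed
qed

text \<open>This is \<open>G \<phi> t\<close> of the overview: the standard delta sequence with the
  integer index replaced by a real parameter.\<close>

definition dilated_pairing ::
  "(('a::euclidean_space \<Rightarrow> complex) \<Rightarrow> complex) \<Rightarrow> 'a \<Rightarrow> ('a \<Rightarrow> complex) \<Rightarrow> real \<Rightarrow> complex" where
  "dilated_pairing f x0 \<phi> t = of_real (t ^ DIM('a)) * f (\<lambda>y. \<phi> (t *\<^sub>R (y - x0)))"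

text \<open>Continuity on a set of reals can be tested on sequences, and a distribution is
  continuous along convergent sequences of dilates.\<close>

lemma continuous_on_dilated_pairing:
  assumes "distribution f" "test_function \<phi>"
  shows "continuous_on {0<..} (dilated_pairing f x0 \<phi>)"
proof -
  have "continuous_on {0<..} (\<lambda>t. f (\<lambda>y. \<phi> (t *\<^sub>R (y - x0))))"
    unfolding continuous_on_sequentially
  proof (intro allI ballI impI)
    fix t0 :: real and t assume "t0 \<in> {0<..}" "(\<forall>k. t k \<in> {0<..}) \<and> t \<longlonglongrightarrow> t0"
    then have "test_function_converges (\<lambda>k y. \<phi> (t k *\<^sub>R (y - x0))) (\<lambda>y. \<phi> (t0 *\<^sub>R (y - x0)))"
      using assms(2) by (intro test_function_converges_dilation) auto
    then show "((\<lambda>t. f (\<lambda>y. \<phi> (t *\<^sub>R (y - x0)))) \<circ> t) \<longlonglongrightarrow> f (\<lambda>y. \<phi> (t0 *\<^sub>R (y - x0)))"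
      using assms(1) by (simp add: distribution_def o_def)
  qed
  then show ?thesis
    unfolding dilated_pairing_def by (intro continuous_intros)
qed

lemma dilated_pairing_add:
  assumes "distribution f" "test_function \<phi>" "test_function \<psi>" "0 < t"
  shows "dilated_pairing f x0 (\<lambda>x. \<phi> x + \<psi> x) t = dilated_pairing f x0 \<phi> t + dilated_pairing f x0 \<psi> t"
proof -
  have "f (\<lambda>y. \<phi> (t *\<^sub>R (y - x0)) + \<psi> (t *\<^sub>R (y - x0))) =
      f (\<lambda>y. \<phi> (t *\<^sub>R (y - x0))) + f (\<lambda>y. \<psi> (t *\<^sub>R (y - x0)))"
    using assms test_function_dilation[of _ t x0] unfolding distribution_def by blast
  then show ?thesis by (simp add: dilated_pairing_def distrib_left)
qed

lemma dilated_pairing_cmult: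
  assumes "distribution f" "test_function \<phi>" "0 < t"
  shows "dilated_pairing f x0 (\<lambda>x. c * \<phi> x) t = c * dilated_pairing f x0 \<phi> t"
proof -
  have "f (\<lambda>y. c * \<phi> (t *\<^sub>R (y - x0))) = c * f (\<lambda>y. \<phi> (t *\<^sub>R (y - x0)))"
    using assms test_function_dilation[of \<phi> t x0] unfolding distribution_def by blast
  then show ?thesis by (simp add: dilated_pairing_def)
qed

section \<open>Leibniz rule and Taylor bound\<close>

text \<open>The product rule leads from a class of products into its finite sums, which are encoded
  by lists. The finite sums of members of \<open>S\<close> form a class to which
  \<open>smooth_coinduct\<close> applies.\<close>

lemma smooth_coinduct_sum_list:
  fixes g :: "'a::euclidean_space \<Rightarrow> 'b::real_normed_vector"
  assumes "g \<in> S"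
    and S: "\<And>g. g \<in> S \<Longrightarrow> \<exists>g'. (\<forall>x. (g has_derivative g' x) (at x)) \<and>
      (\<forall>v\<in>Basis. \<exists>hs. set hs \<subseteq> S \<and> (\<lambda>x. g' x v) = (\<lambda>x. \<Sum>h\<leftarrow>hs. h x))"
  shows "smooth g"
proof -
  define T where "T = {\<lambda>x. \<Sum>h\<leftarrow>hs. h x |hs. set hs \<subseteq> S}"
  have T: "\<exists>g'. (\<forall>x. ((\<lambda>x. \<Sum>h\<leftarrow>hs. h x) has_derivative g' x) (at x)) \<and> (\<forall>v\<in>Basis. (\<lambda>x. g' x v) \<in> T)"
    if "set hs \<subseteq> S" for hs
    using that
  proof (induction hs)
    case Nil
    have "(\<lambda>x. 0) \<in> T" unfolding T_def by (intro CollectI exI[of _ "[]"]) auto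
    then show ?case by (intro exI[of _ "\<lambda>x h. 0"]) auto
  next
    case (Cons k hs)
    then obtain g' where g': "\<And>x. ((\<lambda>x. \<Sum>h\<leftarrow>hs. h x) has_derivative g' x) (at x)"
      "\<And>v. v \<in> Basis \<Longrightarrow> (\<lambda>x. g' x v) \<in> T" by auto
    obtain k' where k': "\<And>x. (k has_derivative k' x) (at x)"
      "\<And>v. v \<in> Basis \<Longrightarrow> \<exists>hs. set hs \<subseteq> S \<and> (\<lambda>x. k' x v) = (\<lambda>x. \<Sum>h\<leftarrow>hs. h x)"
      using S[of k] Cons.prems by (simp, metis)
    have "(\<lambda>x. k' x v + g' x v) \<in> T" if v: "v \<in> Basis" for v
    proof -
      obtain us where us: "set us \<subseteq> S" "(\<lambda>x. k' x v) = (\<lambda>x. \<Sum>h\<leftarrow>us. h x)" using k'(2)[OF v] by blast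
      obtain ws where ws: "set ws \<subseteq> S" "(\<lambda>x. g' x v) = (\<lambda>x. \<Sum>h\<leftarrow>ws. h x)"
        using g'(2)[OF v] unfolding T_def by blast
      show ?thesis
        unfolding T_def
        using us ws by (intro CollectI exI[of _ "us @ ws"]) (simp add: fun_eq_iff)
    qed
    moreover have "((\<lambda>x. \<Sum>h\<leftarrow>k # hs. h x) has_derivative (\<lambda>v. k' x v + g' x v)) (at x)" for x
      using has_derivative_add[OF k'(1) g'(1)] by simp
    ultimately show ?case by (intro exI[of _ "\<lambda>x v. k' x v + g' x v"]) blast
  qed
  show ?thesis
  proof (rule smooth_coinduct)
    show "g \<in> T" unfolding T_def using assms(1) by (intro CollectI exI[of _ "[g]"]) auto
  qed (use T in \<open>auto simp: T_def\<close>)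
qed

text \<open>By the Leibniz rule the products of two smooth functions are closed under
  differentiation up to sums of two members.\<close>

lemma smooth_scaleR:
  fixes \<phi> :: "'a::euclidean_space \<Rightarrow> 'b::real_normed_vector"
  assumes "smooth p" "smooth \<phi>"
  shows "smooth (\<lambda>x. p x *\<^sub>R \<phi> x)"
proof (rule smooth_coinduct_sum_list)
  let ?S = "{\<lambda>x. p x *\<^sub>R \<phi> x |p (\<phi> :: 'a \<Rightarrow> 'b). smooth p \<and> smooth \<phi>}"
  have S: "(\<lambda>x. p x *\<^sub>R \<phi> x) \<in> ?S" if "smooth p" "smooth \<phi>" for p and \<phi> :: "'a \<Rightarrow> 'b"
    using that by (intro CollectI exI conjI) (rule refl)
  show "(\<lambda>x. p x *\<^sub>R \<phi> x) \<in> ?S" by (rule S[OF assms])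
  fix g assume "g \<in> ?S"
  then obtain p \<phi> where g: "g = (\<lambda>x. p x *\<^sub>R \<phi> x)" and *: "smooth p" "smooth (\<phi> :: 'a \<Rightarrow> 'b)" by blast
  show "\<exists>g'. (\<forall>x. (g has_derivative g' x) (at x)) \<and>
      (\<forall>v\<in>Basis. \<exists>hs. set hs \<subseteq> ?S \<and> (\<lambda>x. g' x v) = (\<lambda>x. \<Sum>h\<leftarrow>hs. h x))"
  proof (intro exI conjI allI ballI)
    fix x
    show "(g has_derivative (\<lambda>v. p x *\<^sub>R frechet_derivative \<phi> (at x) v + frechet_derivative p (at x) v *\<^sub>R \<phi> x)) (at x)"
      unfolding g by (rule has_derivative_scaleR[OF smooth_has_derivative smooth_has_derivative]) (use * in auto)
  next
    fix v :: 'a assume v: "v \<in> Basis"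
    let ?hs = "[\<lambda>x. p x *\<^sub>R frechet_derivative \<phi> (at x) v, \<lambda>x. frechet_derivative p (at x) v *\<^sub>R \<phi> x]"
    show "set ?hs \<subseteq> ?S"
      using S[OF *(1) smooth_partial[OF *(2) v]] S[OF smooth_partial[OF *(1) v] *(2)] by simp
    show "(\<lambda>x. p x *\<^sub>R frechet_derivative \<phi> (at x) v + frechet_derivative p (at x) v *\<^sub>R \<phi> x) = (\<lambda>x. \<Sum>h\<leftarrow>?hs. h x)"
      by simp
  qed
qed

lemma smooth_const: "smooth (\<lambda>x. c)"
  by (rule smooth_coinduct[of _ "range (\<lambda>c x. c)"]) (auto intro!: exI[of _ "\<lambda>x h. 0"])

lemma smooth_inner_left: "smooth (\<lambda>x::'a::euclidean_space. x \<bullet> v)"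
proof (rule smooth_coinduct)
  let ?S = "insert (\<lambda>x::'a. x \<bullet> v) (range (\<lambda>c x. c))"
  show "(\<lambda>x. x \<bullet> v) \<in> ?S" by simp
  fix g assume "g \<in> ?S"
  then consider "g = (\<lambda>x. x \<bullet> v)" | c where "g = (\<lambda>x. c)" by auto
  then show "\<exists>g'. (\<forall>x. (g has_derivative g' x) (at x)) \<and> (\<forall>v\<in>Basis. (\<lambda>x. g' x v) \<in> ?S)"
  proof cases
    case 1
    then show ?thesis
      by (intro exI[of _ "\<lambda>x h. h \<bullet> v"]) (auto intro!: derivative_eq_intros)
  next
    case 2
    then show ?thesis by (intro exI[of _ "\<lambda>x h. 0"]) auto
  qed
qed

text \<open>The derivative is expanded in the basis because partial derivatives in basis directions
  are again test functions, so that the formula can be iterated.\<close>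

lemma has_derivative_along_line:
  assumes "test_function \<phi>"
  shows "((\<lambda>s. \<phi> (s *\<^sub>R X)) has_derivative
      (\<lambda>h. h *\<^sub>R (\<Sum>v\<in>Basis. (X \<bullet> v) *\<^sub>R frechet_derivative \<phi> (at (s *\<^sub>R X)) v))) (at s)"
proof -
  let ?D = "frechet_derivative \<phi> (at (s *\<^sub>R X))"
  have D: "(\<phi> has_derivative ?D) (at (s *\<^sub>R X))"
    using assms smooth_has_derivative test_function_smooth by blast
  have lin: "linear ?D" using D has_derivative_linear by blast
  have "((\<lambda>s. s *\<^sub>R X) has_derivative (\<lambda>h. h *\<^sub>R X)) (at s)"
    by (auto intro!: derivative_eq_intros)
  from has_derivative_compose[OF this D]
  have "((\<lambda>s. \<phi> (s *\<^sub>R X)) has_derivative (\<lambda>h. ?D (h *\<^sub>R X))) (at s)" .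
  moreover have "?D (h *\<^sub>R X) = h *\<^sub>R (\<Sum>v\<in>Basis. (X \<bullet> v) *\<^sub>R ?D v)" for h
  proof -
    have "?D X = ?D (\<Sum>v\<in>Basis. (X \<bullet> v) *\<^sub>R v)" by (simp add: euclidean_representation)
    also have "\<dots> = (\<Sum>v\<in>Basis. (X \<bullet> v) *\<^sub>R ?D v)"
      by (simp add: linear_sum[OF lin] linear_scale[OF lin])
    finally show ?thesis by (simp add: linear_scale[OF lin])
  qed
  ultimately show ?thesis by simp
qed

text \<open>The partial derivatives are Lipschitz, and the mean value inequality turns this into a
  quadratic remainder. Uniformity in \<open>X\<close> and \<open>s\<close> allows the estimate to be
  integrated over a finite measure.\<close>

lemma test_function_taylor_bound:
  fixes \<phi> :: "'a::euclidean_space \<Rightarrow> complex"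
  assumes "test_function \<phi>"
  obtains C where "0 < C" "\<And>X s h. norm X \<le> 1 \<Longrightarrow>
    norm (\<phi> ((s + h) *\<^sub>R X) - \<phi> (s *\<^sub>R X) -
      h *\<^sub>R (\<Sum>v\<in>Basis. (X \<bullet> v) *\<^sub>R frechet_derivative \<phi> (at (s *\<^sub>R X)) v)) \<le> C * h\<^sup>2"
proof -
  let ?D = "\<lambda>v x. frechet_derivative \<phi> (at x) v"
  have "\<forall>v\<in>Basis. \<exists>L>0. \<forall>x y. norm (?D v x - ?D v y) \<le> L * norm (x - y)"
  proof
    fix v :: 'a assume "v \<in> Basis"
    then show "\<exists>L>0. \<forall>x y. norm (?D v x - ?D v y) \<le> L * norm (x - y)"
      using test_function_lipschitz[OF test_function_partial[OF assms]] by blast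
  qed
  then obtain L where L: "\<And>v. v \<in> Basis \<Longrightarrow> 0 < L v"
    "\<And>v x y. v \<in> Basis \<Longrightarrow> norm (?D v x - ?D v y) \<le> L v * norm (x - y)"
    by metis
  define C where "C = sum L Basis"
  have "0 < C" unfolding C_def using L(1) by (intro sum_pos) auto
  have "norm (\<phi> ((s + h) *\<^sub>R X) - \<phi> (s *\<^sub>R X) - h *\<^sub>R (\<Sum>v\<in>Basis. (X \<bullet> v) *\<^sub>R ?D v (s *\<^sub>R X))) \<le> C * h\<^sup>2"
    if X: "norm X \<le> 1" for X s h
  proof -
    let ?c = "\<Sum>v\<in>Basis. (X \<bullet> v) *\<^sub>R ?D v (s *\<^sub>R X)"
    \<comment> \<open>Removing the linear part at \<open>s\<close> leaves a function whose
      derivative vanishes at \<open>s\<close> and is at most \<open>C * \<bar>h\<bar>\<close> on the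
      segment.\<close>
    let ?u = "\<lambda>t. \<phi> (t *\<^sub>R X) - t *\<^sub>R ?c"
    have der: "(?u has_derivative (\<lambda>k. k *\<^sub>R ((\<Sum>v\<in>Basis. (X \<bullet> v) *\<^sub>R ?D v (t *\<^sub>R X)) - ?c))) (at t within A)" for t A
      using has_derivative_diff[OF has_derivative_along_line[OF assms, of X t] has_derivative_scaleR_left[OF has_derivative_ident, of ?c]]
      by (simp add: scaleR_diff_right has_derivative_at_withinI)
    have "norm (?u (s + h) - ?u s) \<le> (C * \<bar>h\<bar>) * norm (s + h - s)"
    proof (rule differentiable_bound[OF convex_closed_segment der])
      fix t assume t: "t \<in> closed_segment s (s + h)"
      then have "\<bar>t - s\<bar> \<le> \<bar>h\<bar>" by (auto simp: closed_segment_eq_real_ivl split: if_splits)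
      have "norm ((\<Sum>v\<in>Basis. (X \<bullet> v) *\<^sub>R ?D v (t *\<^sub>R X)) - ?c) =
          norm (\<Sum>v\<in>Basis. (X \<bullet> v) *\<^sub>R (?D v (t *\<^sub>R X) - ?D v (s *\<^sub>R X)))"
        by (simp add: sum_subtractf scaleR_diff_right)
      also have "\<dots> \<le> (\<Sum>v\<in>Basis. L v * \<bar>h\<bar>)"
      proof (intro order.trans[OF norm_sum] sum_mono)
        fix v :: 'a assume v: "v \<in> Basis"
        have "norm (?D v (t *\<^sub>R X) - ?D v (s *\<^sub>R X)) \<le> L v * norm (t *\<^sub>R X - s *\<^sub>R X)"
          by (rule L(2)[OF v])
        also have "\<dots> = L v * (\<bar>t - s\<bar> * norm X)"
          by (simp add: scaleR_left_diff_distrib[symmetric])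
        also have "\<dots> \<le> L v * (\<bar>h\<bar> * 1)"
          using L(1)[OF v] X \<open>\<bar>t - s\<bar> \<le> \<bar>h\<bar>\<close> by (intro mult_left_mono mult_mono) auto
        finally have "norm (?D v (t *\<^sub>R X) - ?D v (s *\<^sub>R X)) \<le> L v * \<bar>h\<bar>" by simp
        moreover have "\<bar>X \<bullet> v\<bar> \<le> 1" using X Basis_le_norm[OF v, of X] by linarith
        ultimately have "\<bar>X \<bullet> v\<bar> * norm (?D v (t *\<^sub>R X) - ?D v (s *\<^sub>R X)) \<le> 1 * (L v * \<bar>h\<bar>)"
          by (intro mult_mono) auto
        then show "norm ((X \<bullet> v) *\<^sub>R (?D v (t *\<^sub>R X) - ?D v (s *\<^sub>R X))) \<le> L v * \<bar>h\<bar>" by simp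
      qed
      also have "\<dots> = C * \<bar>h\<bar>" by (simp add: C_def sum_distrib_right)
      finally have *: "norm ((\<Sum>v\<in>Basis. (X \<bullet> v) *\<^sub>R ?D v (t *\<^sub>R X)) - ?c) \<le> C * \<bar>h\<bar>" .
      show "onorm (\<lambda>k. k *\<^sub>R ((\<Sum>v\<in>Basis. (X \<bullet> v) *\<^sub>R ?D v (t *\<^sub>R X)) - ?c)) \<le> C * \<bar>h\<bar>"
        using * \<open>0 < C\<close> by (intro onorm_bound) (auto simp: mult.commute intro: mult_left_mono)
    qed auto
    then show ?thesis by (simp add: algebra_simps power2_eq_square)
  qed
  then show ?thesis using \<open>0 < C\<close> that by blast
qed

section \<open>Differentiation under the integral sign\<close>

lemma integrable_dilation_family:
  fixes \<phi> :: "'a::euclidean_space \<Rightarrow> complex"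
  assumes "finite_measure M" "X \<in> borel_measurable M" "a \<in> borel_measurable M"
    and a: "\<And>\<omega>. \<omega> \<in> space M \<Longrightarrow> \<bar>a \<omega>\<bar> \<le> A"
    and "test_function \<phi>"
  shows "integrable M (\<lambda>\<omega>. a \<omega> *\<^sub>R \<phi> (r *\<^sub>R X \<omega>))"
proof -
  interpret finite_measure M by fact
  have [measurable]: "\<phi> \<in> borel_measurable borel" "X \<in> borel_measurable M" "a \<in> borel_measurable M"
    using assms test_function_borel_measurable by auto
  obtain B where B: "0 < B" "\<And>x. norm (\<phi> x) \<le> B" using test_function_bounded[OF assms(5)] by blast
  show ?thesis
  proof (rule integrable_const_bound)
    show "AE \<omega> in M. norm (a \<omega> *\<^sub>R \<phi> (r *\<^sub>R X \<omega>)) \<le> A * B"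
    proof (rule AE_I2)
      fix \<omega> assume "\<omega> \<in> space M"
      then show "norm (a \<omega> *\<^sub>R \<phi> (r *\<^sub>R X \<omega>)) \<le> A * B"
        using a[of \<omega>] B by (auto intro!: mult_mono)
    qed
  qed measurable
qed

text \<open>Integrating the uniform Taylor bound against the bounded weight \<open>a\<close> leaves
  a remainder of at most \<open>K * h\<^sup>2\<close>. The weight is carried along because each
  differentiation multiplies it by a coordinate of \<open>X\<close>.\<close>

lemma has_derivative_dilation_integral:
  fixes \<phi> :: "'a::euclidean_space \<Rightarrow> complex"
  assumes M: "finite_measure M" and X: "X \<in> borel_measurable M" "\<And>\<omega>. \<omega> \<in> space M \<Longrightarrow> norm (X \<omega>) \<le> 1"
    and a: "a \<in> borel_measurable M" "\<And>\<omega>. \<omega> \<in> space M \<Longrightarrow> \<bar>a \<omega>\<bar> \<le> A"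
    and \<phi>: "test_function \<phi>"
  shows "((\<lambda>r. LINT \<omega>|M. a \<omega> *\<^sub>R \<phi> (r *\<^sub>R X \<omega>)) has_derivative
    (\<lambda>h. h *\<^sub>R (\<Sum>v\<in>Basis. LINT \<omega>|M. (a \<omega> * (X \<omega> \<bullet> v)) *\<^sub>R frechet_derivative \<phi> (at (r *\<^sub>R X \<omega>)) v))) (at r)"
proof -
  interpret finite_measure M by fact
  let ?D = "\<lambda>v x. frechet_derivative \<phi> (at x) v"
  let ?I = "\<lambda>r. LINT \<omega>|M. a \<omega> *\<^sub>R \<phi> (r *\<^sub>R X \<omega>)"
  let ?J = "\<lambda>v. LINT \<omega>|M. (a \<omega> * (X \<omega> \<bullet> v)) *\<^sub>R ?D v (r *\<^sub>R X \<omega>)"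
  have [measurable]: "X \<in> borel_measurable M" "a \<in> borel_measurable M" by fact+
  have intI: "integrable M (\<lambda>\<omega>. a \<omega> *\<^sub>R \<phi> (r *\<^sub>R X \<omega>))" for r
    by (rule integrable_dilation_family[OF M X(1) a \<phi>])
  have intJ: "integrable M (\<lambda>\<omega>. (a \<omega> * (X \<omega> \<bullet> v)) *\<^sub>R ?D v (r *\<^sub>R X \<omega>))" if v: "v \<in> Basis" for v
  proof (rule integrable_dilation_family[OF M X(1) _ _ test_function_partial[OF \<phi> v]])
    fix \<omega> assume \<omega>: "\<omega> \<in> space M"
    have "\<bar>X \<omega> \<bullet> v\<bar> \<le> 1" using X(2)[OF \<omega>] Basis_le_norm[OF v, of "X \<omega>"] by linarith
    then have "\<bar>a \<omega>\<bar> * \<bar>X \<omega> \<bullet> v\<bar> \<le> A * 1" using a(2)[OF \<omega>] by (intro mult_mono) auto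
    then show "\<bar>a \<omega> * (X \<omega> \<bullet> v)\<bar> \<le> A" by (simp add: abs_mult)
  qed measurable
  obtain C where C: "0 < C" "\<And>X s h. norm X \<le> 1 \<Longrightarrow>
    norm (\<phi> ((s + h) *\<^sub>R X) - \<phi> (s *\<^sub>R X) - h *\<^sub>R (\<Sum>v\<in>Basis. (X \<bullet> v) *\<^sub>R ?D v (s *\<^sub>R X))) \<le> C * h\<^sup>2"
    using test_function_taylor_bound[OF \<phi>] by blast
  define K where "K = A * C * measure M (space M)"
  have bound: "norm (?I (r + h) - ?I r - h *\<^sub>R (\<Sum>v\<in>Basis. ?J v)) \<le> K * h\<^sup>2" for h
  proof -
    let ?R = "\<lambda>\<omega>. a \<omega> *\<^sub>R \<phi> ((r + h) *\<^sub>R X \<omega>) - a \<omega> *\<^sub>R \<phi> (r *\<^sub>R X \<omega>) -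
        h *\<^sub>R (\<Sum>v\<in>Basis. (a \<omega> * (X \<omega> \<bullet> v)) *\<^sub>R ?D v (r *\<^sub>R X \<omega>))"
    have intR: "integrable M ?R"
      using intI intJ by (intro Bochner_Integration.integrable_diff integrable_scaleR_right Bochner_Integration.integrable_sum) auto
    have "?I (r + h) - ?I r - h *\<^sub>R (\<Sum>v\<in>Basis. ?J v) = (LINT \<omega>|M. ?R \<omega>)"
      using intI intJ by (simp add: Bochner_Integration.integral_diff Bochner_Integration.integral_sum)
    also have "norm \<dots> \<le> (LINT \<omega>|M. norm (?R \<omega>))" by (rule integral_norm_bound)
    also have "\<dots> \<le> (LINT \<omega>|M. A * (C * h\<^sup>2))"
    proof (rule integral_mono)
      fix \<omega> assume \<omega>: "\<omega> \<in> space M"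
      have "?R \<omega> = a \<omega> *\<^sub>R (\<phi> ((r + h) *\<^sub>R X \<omega>) - \<phi> (r *\<^sub>R X \<omega>) -
          h *\<^sub>R (\<Sum>v\<in>Basis. (X \<omega> \<bullet> v) *\<^sub>R ?D v (r *\<^sub>R X \<omega>)))"
        by (simp add: scaleR_diff_right scaleR_sum_right mult_ac)
      then have "norm (?R \<omega>) = \<bar>a \<omega>\<bar> * norm (\<phi> ((r + h) *\<^sub>R X \<omega>) - \<phi> (r *\<^sub>R X \<omega>) -
          h *\<^sub>R (\<Sum>v\<in>Basis. (X \<omega> \<bullet> v) *\<^sub>R ?D v (r *\<^sub>R X \<omega>)))"
        by simp
      also have "\<dots> \<le> A * (C * h\<^sup>2)"
        using a(2)[OF \<omega>] C(2)[OF X(2)[OF \<omega>], of r h] by (intro mult_mono) auto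
      finally show "norm (?R \<omega>) \<le> A * (C * h\<^sup>2)" .
    qed (use intR in auto)
    also have "\<dots> = K * h\<^sup>2" by (simp add: K_def mult_ac)
    finally show ?thesis .
  qed
  show ?thesis
    unfolding has_derivative_at
  proof (intro conjI)
    show "bounded_linear (\<lambda>h. h *\<^sub>R (\<Sum>v\<in>Basis. ?J v))"
      by (rule bounded_linear_scaleR_left)
    show "(\<lambda>h. norm (?I (r + h) - ?I r - h *\<^sub>R (\<Sum>v\<in>Basis. ?J v)) / norm h) \<midarrow>0\<rightarrow> 0"
    proof (rule Lim_null_comparison)
      show "\<forall>\<^sub>F h in at 0. norm (norm (?I (r + h) - ?I r - h *\<^sub>R (\<Sum>v\<in>Basis. ?J v)) / norm h) \<le> K * \<bar>h\<bar>"
        unfolding eventually_at_filter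
      proof (intro always_eventually allI impI)
        fix h :: real assume "h \<noteq> 0"
        then show "norm (norm (?I (r + h) - ?I r - h *\<^sub>R (\<Sum>v\<in>Basis. ?J v)) / norm h) \<le> K * \<bar>h\<bar>"
          using bound[of h] by (simp add: pos_divide_le_eq mult.assoc power2_eq_square)
      qed
      have "((\<lambda>h. K * \<bar>h\<bar>) \<longlongrightarrow> K * \<bar>0\<bar>) (at 0)" by (intro tendsto_intros)
      then show "(\<lambda>h. K * \<bar>h\<bar>) \<midarrow>0\<rightarrow> 0" by simp
    qed
  qed
qed

text \<open>The integrals of this shape, with any bounded weight and any test function, are closed
  under differentiation up to finite sums. The applications are spherical means, with
  \<open>X\<close> the direction \<open>sgn\<close>, and the quotient \<open>\<psi>' r / r\<close>,
  with \<open>X\<close> the variable of \<open>[0, 1]\<close>.\<close>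

lemma smooth_dilation_integral:
  fixes \<phi> :: "'a::euclidean_space \<Rightarrow> complex"
  assumes M: "finite_measure M" and X: "X \<in> borel_measurable M" "\<And>\<omega>. \<omega> \<in> space M \<Longrightarrow> norm (X \<omega>) \<le> 1"
    and a: "a \<in> borel_measurable M" "\<And>\<omega>. \<omega> \<in> space M \<Longrightarrow> \<bar>a \<omega>\<bar> \<le> A"
    and \<phi>: "test_function \<phi>"
  shows "smooth (\<lambda>r::real. LINT \<omega>|M. a \<omega> *\<^sub>R \<phi> (r *\<^sub>R X \<omega>))"
proof (rule smooth_coinduct_sum_list)
  let ?I = "\<lambda>a \<phi> r. LINT \<omega>|M. a \<omega> *\<^sub>R \<phi> (r *\<^sub>R X \<omega>)"
  define S where "S = {?I a \<phi> |a (\<phi> :: 'a \<Rightarrow> complex).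
    a \<in> borel_measurable M \<and> (\<exists>A. \<forall>\<omega>\<in>space M. \<bar>a \<omega>\<bar> \<le> A) \<and> test_function \<phi>}"
  have S: "?I a \<phi> \<in> S" if "a \<in> borel_measurable M" "\<forall>\<omega>\<in>space M. \<bar>a \<omega>\<bar> \<le> A" "test_function \<phi>" for a \<phi> A
    unfolding S_def using that by (intro CollectI exI conjI) (rule refl)
  show "?I a \<phi> \<in> S" using assms by (intro S) auto
  fix g assume "g \<in> S"
  then obtain a A \<phi> where g: "g = ?I a \<phi>" and a: "a \<in> borel_measurable M" "\<And>\<omega>. \<omega> \<in> space M \<Longrightarrow> \<bar>a \<omega>\<bar> \<le> A"
    and \<phi>: "test_function \<phi>"
    unfolding S_def by auto
  let ?J = "\<lambda>v. ?I (\<lambda>\<omega>. a \<omega> * (X \<omega> \<bullet> v)) (\<lambda>x. frechet_derivative \<phi> (at x) v)"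
  have J: "?J v \<in> S" if v: "v \<in> Basis" for v
  proof (rule S[OF _ _ test_function_partial[OF \<phi> v]])
    show "(\<lambda>\<omega>. a \<omega> * (X \<omega> \<bullet> v)) \<in> borel_measurable M" using a X(1) by measurable
    show "\<forall>\<omega>\<in>space M. \<bar>a \<omega> * (X \<omega> \<bullet> v)\<bar> \<le> A"
    proof
      fix \<omega> assume \<omega>: "\<omega> \<in> space M"
      have "\<bar>X \<omega> \<bullet> v\<bar> \<le> 1" using X(2)[OF \<omega>] Basis_le_norm[OF v, of "X \<omega>"] by linarith
      then have "\<bar>a \<omega>\<bar> * \<bar>X \<omega> \<bullet> v\<bar> \<le> A * 1" using a(2)[OF \<omega>] by (intro mult_mono) auto
      then show "\<bar>a \<omega> * (X \<omega> \<bullet> v)\<bar> \<le> A" by (simp add: abs_mult)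
    qed
  qed
  \<comment> \<open>An enumeration of the basis turns the sum over it into the sum over a list
    required by the coinduction rule.\<close>
  obtain bs :: "'a list" where bs: "set bs = Basis" "distinct bs"
    using finite_distinct_list[OF finite_Basis] by blast
  show "\<exists>g'. (\<forall>x. (g has_derivative g' x) (at x)) \<and>
      (\<forall>v\<in>Basis. \<exists>hs. set hs \<subseteq> S \<and> (\<lambda>x. g' x v) = (\<lambda>x. \<Sum>h\<leftarrow>hs. h x))"
  proof (intro exI conjI allI ballI)
    show "(g has_derivative (\<lambda>h. h *\<^sub>R (\<Sum>v\<in>Basis. ?J v r))) (at r)" for r
      unfolding g by (rule has_derivative_dilation_integral[OF M X a \<phi>])
    fix v :: real assume "v \<in> Basis"
    show "set (map ?J bs) \<subseteq> S" using J bs by auto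
    \<comment> \<open>The only basis vector of the reals is 1, so the factor \<open>v\<close>
      disappears.\<close>
    show "(\<lambda>r. v *\<^sub>R (\<Sum>v\<in>Basis. ?J v r)) = (\<lambda>r. \<Sum>h\<leftarrow>map ?J bs. h r)"
      using \<open>v \<in> Basis\<close> bs by (simp add: sum_list_distinct_conv_sum_set o_def)
  qed
qed

section \<open>Radial functions with an even profile\<close>

definition even_test_function :: "(real \<Rightarrow> complex) \<Rightarrow> bool" where
  "even_test_function \<psi> \<longleftrightarrow> test_function \<psi> \<and> (\<forall>r. \<psi> (- r) = \<psi> r)"

lemma test_function_real_has_vector_derivative:
  fixes \<psi> :: "real \<Rightarrow> complex"
  assumes "test_function \<psi>"
  shows "(\<psi> has_vector_derivative frechet_derivative \<psi> (at r) 1) (at r)"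
proof -
  have D: "(\<psi> has_derivative frechet_derivative \<psi> (at r)) (at r)"
    using assms smooth_has_derivative test_function_smooth by blast
  have "frechet_derivative \<psi> (at r) h = h *\<^sub>R frechet_derivative \<psi> (at r) 1" for h
    using linear_scale[OF has_derivative_linear[OF D], of h 1] by simp
  then have "frechet_derivative \<psi> (at r) = (\<lambda>h. h *\<^sub>R frechet_derivative \<psi> (at r) 1)" by blast
  then show ?thesis
    using D unfolding has_vector_derivative_def by metis
qed

text \<open>Defining \<open>\<eta>\<close> as an integral of \<open>\<psi>''\<close> instead of a
  quotient makes it smooth at the origin too. Its support and parity are then read off from
  \<open>r *\<^sub>R \<eta> r = \<psi>' r\<close>.\<close>

lemma even_test_function_derivative_quotient:
  assumes "even_test_function \<psi>"
  obtains \<eta> where "even_test_function \<eta>" "\<And>r. (\<psi> has_vector_derivative r *\<^sub>R \<eta> r) (at r)"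
proof -
  have \<psi>: "test_function \<psi>" and ev: "\<And>r. \<psi> (- r) = \<psi> r"
    using assms by (auto simp: even_test_function_def)
  define \<psi>' where "\<psi>' = (\<lambda>r. frechet_derivative \<psi> (at r) 1)"
  define \<psi>'' where "\<psi>'' = (\<lambda>r. frechet_derivative \<psi>' (at r) 1)"
  have t': "test_function \<psi>'" unfolding \<psi>'_def by (rule test_function_partial[OF \<psi>]) simp
  have t'': "test_function \<psi>''" unfolding \<psi>''_def by (rule test_function_partial[OF t']) simp
  have d: "(\<psi> has_vector_derivative \<psi>' r) (at r)" for r
    unfolding \<psi>'_def by (rule test_function_real_has_vector_derivative[OF \<psi>])
  have d': "(\<psi>' has_vector_derivative \<psi>'' r) (at r)" for r
    unfolding \<psi>''_def by (rule test_function_real_has_vector_derivative[OF t'])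
  have odd: "\<psi>' (- r) = - \<psi>' r" for r
  proof -
    have "(uminus has_vector_derivative - 1) (at (- r))"
      by (auto intro!: derivative_eq_intros)
    then have "((\<psi> \<circ> uminus) has_vector_derivative (- 1) *\<^sub>R \<psi>' r) (at (- r))"
      using d[of r] by (intro vector_diff_chain_at) auto
    moreover have "\<psi> \<circ> uminus = \<psi>" using ev by (auto simp: o_def)
    ultimately have "(\<psi> has_vector_derivative - \<psi>' r) (at (- r))" by simp
    then show ?thesis using d[of "- r"] vector_derivative_unique_at by blast
  qed
  \<comment> \<open>Lebesgue measure on \<open>[0, 1]\<close>, so that
    \<open>smooth_dilation_integral\<close> applies with the identity as \<open>X\<close> and weight
    1.\<close>
  define M where "M = restrict_space (lborel :: real measure) {0..1}"
  have fin: "finite_measure M"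
    unfolding M_def by (intro finite_measureI) (simp add: emeasure_restrict_space space_restrict_space)
  define \<eta> where "\<eta> = (\<lambda>r. LINT t|M. (1::real) *\<^sub>R \<psi>'' (r *\<^sub>R t))"
  have sm: "smooth \<eta>"
    unfolding \<eta>_def
    by (rule smooth_dilation_integral[OF fin, where A = 1])
      (auto simp: M_def space_restrict_space t'' intro: measurable_restrict_space1)
  have eq: "r *\<^sub>R \<eta> r = \<psi>' r" for r
  proof -
    have der: "((\<lambda>t. \<psi>' (t * r)) has_vector_derivative r *\<^sub>R \<psi>'' (t * r)) (at t within {0..1})" for t
    proof -
      have "((\<lambda>t. t * r) has_vector_derivative r) (at t)"
        by (auto intro!: derivative_eq_intros)
      then have "((\<psi>' \<circ> (\<lambda>t. t * r)) has_vector_derivative r *\<^sub>R \<psi>'' (t * r)) (at t)"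
        using d' by (rule vector_diff_chain_at)
      then show ?thesis by (simp add: o_def has_vector_derivative_at_within)
    qed
    have cont: "continuous_on {0..1} (\<lambda>t. r *\<^sub>R \<psi>'' (t * r))"
      by (intro continuous_intros continuous_on_compose2[OF smooth_continuous_on[OF test_function_smooth[OF t''], of UNIV]]) auto
    have "r *\<^sub>R \<eta> r = (LINT t|M. r *\<^sub>R \<psi>'' (t * r))"
      unfolding \<eta>_def by (simp add: mult.commute)
    also have "\<dots> = (LINT t|lborel. indicator {0..1} t *\<^sub>R (r *\<^sub>R \<psi>'' (t * r)))"
      unfolding M_def by (subst integral_restrict_space) auto
    also have "\<dots> = \<psi>' (1 * r) - \<psi>' (0 * r)"
      by (rule integral_FTC_atLeastAtMost[OF _ _ cont]) (use der in auto)
    \<comment> \<open>An odd function vanishes at 0, which removes the lower boundary term.\<close>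
    also have "\<psi>' (0 * r) = 0" using odd[of 0] by simp
    finally show ?thesis by simp
  qed
  show thesis
  proof
    show "(\<psi> has_vector_derivative r *\<^sub>R \<eta> r) (at r)" for r
      unfolding eq by (rule d)
    obtain R where R: "0 < R" "\<And>x. R < norm x \<Longrightarrow> \<psi>' x = 0" using test_functionE[OF t'] by blast
    have "\<eta> r = 0" if "R < norm r" for r
      using R eq[of r] that by (auto simp: scaleR_eq_0_iff)
    then have "test_function \<eta>" using sm by (intro test_functionI[of \<eta> R]) auto
    moreover have "\<eta> (- r) = \<eta> r" for r
    proof (cases "r = 0")
      case False
      have "r *\<^sub>R \<eta> (- r) = r *\<^sub>R \<eta> r" using eq[of r] eq[of "- r"] odd[of r] by simp
      then show ?thesis using False by simp
    qed simp
    ultimately show "even_test_function \<eta>" by (simp add: even_test_function_def)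
  qed
qed

text \<open>The norm is not differentiable at the origin, but there the derivative of
  \<open>\<psi>\<close> vanishes and the difference quotient still tends to 0. Elsewhere the chain
  rule yields \<open>sgn x\<close> times \<open>norm x\<close>, which is \<open>x\<close>.\<close>

lemma has_derivative_compose_norm:
  fixes \<psi> :: "real \<Rightarrow> 'b::real_normed_vector"
  assumes "\<And>r. (\<psi> has_vector_derivative r *\<^sub>R \<eta> r) (at r)"
  shows "((\<lambda>x::'a::euclidean_space. \<psi> (norm x)) has_derivative (\<lambda>h. (x \<bullet> h) *\<^sub>R \<eta> (norm x))) (at x)"
proof (cases "x = 0")
  case True
  have "(\<psi> has_derivative (\<lambda>h. 0)) (at 0)"
    using assms[of 0] by (simp add: has_vector_derivative_def)
  then have lim: "(\<lambda>h. norm (\<psi> h - \<psi> 0) / norm h) \<midarrow>0\<rightarrow> 0"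
    by (simp add: has_derivative_at)
  have "filterlim norm (at (0::real)) (at (0::'a))"
    unfolding filterlim_at by (auto intro!: tendsto_eq_intros simp: eventually_at_filter)
  from filterlim_compose[OF lim this]
  have "(\<lambda>h::'a. norm (\<psi> (norm h) - \<psi> 0) / norm h) \<midarrow>0\<rightarrow> 0" by simp
  then show ?thesis using True by (simp add: has_derivative_at)
next
  case False
  have "(\<psi> has_derivative (\<lambda>h. h *\<^sub>R (norm x *\<^sub>R \<eta> (norm x)))) (at (norm x))"
    using assms[of "norm x"] by (simp add: has_vector_derivative_def)
  from has_derivative_compose[OF has_derivative_norm[OF False] this]
  have *: "((\<lambda>x. \<psi> (norm x)) has_derivative (\<lambda>h. (sgn x \<bullet> h) *\<^sub>R (norm x *\<^sub>R \<eta> (norm x)))) (at x)"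
    by (simp add: inner_commute)
  have "(sgn x \<bullet> h) *\<^sub>R (norm x *\<^sub>R \<eta> (norm x)) = (x \<bullet> h) *\<^sub>R \<eta> (norm x)" for h
    using False by (simp add: sgn_div_norm)
  with * show ?thesis by (simp only:)
qed

text \<open>The functions \<open>p x *\<^sub>R \<psi> (norm x)\<close> with \<open>p\<close> smooth
  and \<open>\<psi>\<close> an even test function are closed under differentiation up to sums:
  either \<open>p\<close> is differentiated, or \<open>\<psi>\<close> is replaced by its derivative
  quotient \<open>\<eta>\<close> while the coordinate \<open>x \<bullet> v\<close> joins
  \<open>p\<close>.\<close>

lemma test_function_compose_norm:
  assumes "even_test_function \<psi>"
  shows "test_function (\<lambda>x::'a::euclidean_space. \<psi> (norm x))"
proof -
  obtain R where R: "\<And>x. R < norm x \<Longrightarrow> \<psi> x = 0"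
    using assms test_functionE unfolding even_test_function_def by metis
  define S where "S = {\<lambda>x::'a. p x *\<^sub>R \<psi> (norm x) |(p :: 'a \<Rightarrow> real) \<psi>. smooth p \<and> even_test_function \<psi>}"
  have S: "(\<lambda>x. p x *\<^sub>R \<psi> (norm x)) \<in> S" if "smooth p" "even_test_function \<psi>" for p \<psi>
    unfolding S_def using that by (intro CollectI exI conjI) (rule refl)
  have "smooth (\<lambda>x::'a. 1 *\<^sub>R \<psi> (norm x))"
  proof (rule smooth_coinduct_sum_list)
    show "(\<lambda>x::'a. 1 *\<^sub>R \<psi> (norm x)) \<in> S" by (rule S[OF smooth_const assms])
    fix g assume "g \<in> S"
    then obtain p \<psi> where g: "g = (\<lambda>x. p x *\<^sub>R \<psi> (norm x))" and p: "smooth p" and \<psi>: "even_test_function \<psi>"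
      unfolding S_def by auto
    obtain \<eta> where \<eta>: "even_test_function \<eta>" "\<And>r. (\<psi> has_vector_derivative r *\<^sub>R \<eta> r) (at r)"
      using even_test_function_derivative_quotient[OF \<psi>] by blast
    let ?hs = "\<lambda>v. [\<lambda>x. (p x *\<^sub>R (x \<bullet> v)) *\<^sub>R \<eta> (norm x), \<lambda>x. frechet_derivative p (at x) v *\<^sub>R \<psi> (norm x)]"
    show "\<exists>g'. (\<forall>x. (g has_derivative g' x) (at x)) \<and>
        (\<forall>v\<in>Basis. \<exists>hs. set hs \<subseteq> S \<and> (\<lambda>x. g' x v) = (\<lambda>x. \<Sum>h\<leftarrow>hs. h x))"
    proof (intro exI conjI allI ballI)
      show "(g has_derivative (\<lambda>h. p x *\<^sub>R ((x \<bullet> h) *\<^sub>R \<eta> (norm x)) + frechet_derivative p (at x) h *\<^sub>R \<psi> (norm x))) (at x)" for x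
        unfolding g by (rule has_derivative_scaleR[OF smooth_has_derivative[OF p] has_derivative_compose_norm[OF \<eta>(2)]])
      fix v :: 'a assume v: "v \<in> Basis"
      show "set (?hs v) \<subseteq> S"
        using S[OF smooth_scaleR[OF p smooth_inner_left] \<eta>(1), of v] S[OF smooth_partial[OF p v] \<psi>] by simp
      show "(\<lambda>x. p x *\<^sub>R ((x \<bullet> v) *\<^sub>R \<eta> (norm x)) + frechet_derivative p (at x) v *\<^sub>R \<psi> (norm x)) = (\<lambda>x. \<Sum>h\<leftarrow>?hs v. h x)"
        by simp
    qed
  qed
  then show ?thesis using R by (intro test_functionI[of _ R]) auto
qed

section \<open>Polar coordinates\<close>

lemma borel_measurable_sgn [measurable]: "sgn \<in> borel_measurable (borel :: 'a::euclidean_space measure)"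
  unfolding sgn_div_norm[abs_def] by measurable

lemma nn_integral_lborel_scaleR:
  fixes f :: "'a::euclidean_space \<Rightarrow> ennreal"
  assumes [measurable]: "f \<in> borel_measurable borel" and c: "c \<noteq> 0"
  shows "(\<integral>\<^sup>+x. f x \<partial>lborel) = (\<integral>\<^sup>+x. ennreal (\<bar>c\<bar> ^ DIM('a)) * f (c *\<^sub>R x) \<partial>lborel)"
  by (subst lborel_affine[OF c, of 0])
     (simp add: nn_integral_density nn_integral_distr)

lemma integral_lborel_scaleR:
  fixes f :: "'a::euclidean_space \<Rightarrow> 'b::{banach, second_countable_topology}"
  assumes [measurable]: "f \<in> borel_measurable borel" and c: "c \<noteq> 0"
  shows "(LINT x|lborel. f x) = \<bar>c\<bar> ^ DIM('a) *\<^sub>R (LINT x|lborel. f (c *\<^sub>R x))"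
  by (subst lborel_affine[OF c, of 0])
     (simp add: integral_density integral_distr)

lemma sgn_scaleR_pos: "0 < c \<Longrightarrow> sgn (c *\<^sub>R x) = sgn (x :: 'a::real_normed_vector)"
  by (simp add: sgn_scaleR)

lemma scaleR_norm_sgn: "norm x *\<^sub>R sgn x = (x :: 'a::real_normed_vector)"
  by (cases "x = 0") (simp_all add: sgn_div_norm)

lemma nn_integral_lborel_swap:
  fixes f :: "'a::euclidean_space \<Rightarrow> 'b::euclidean_space \<Rightarrow> ennreal"
  assumes "case_prod f \<in> borel_measurable (lborel \<Otimes>\<^sub>M lborel)"
  shows "(\<integral>\<^sup>+x. \<integral>\<^sup>+y. f x y \<partial>lborel \<partial>lborel) = (\<integral>\<^sup>+y. \<integral>\<^sup>+x. f x y \<partial>lborel \<partial>lborel)"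
  using lborel_pair.Fubini'[OF assms] by simp

text \<open>Scaling \<open>y\<close> by the norm of \<open>x\<close>, then \<open>x\<close> by that of \<open>y\<close>, then \<open>y\<close> by the inverse norm of \<open>x\<close>
  turns the argument of \<open>g\<close> into the plain variable \<open>y\<close>; a last scaling of \<open>x\<close> splits off the
  constant. The constant is identified afterwards by taking \<open>g\<close> to be the indicator of the unit ball.\<close>

lemma nn_integral_directions_eq_cmult:
  obtains C where "\<And>g :: 'a::euclidean_space \<Rightarrow> ennreal. g \<in> borel_measurable borel \<Longrightarrow>
    (\<integral>\<^sup>+x. \<integral>\<^sup>+y. (if norm y < 1 then g (norm x *\<^sub>R sgn y) else 0) \<partial>lborel \<partial>(lborel :: 'a measure)) = C * (\<integral>\<^sup>+x. g x \<partial>lborel)"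
proof
  fix g :: "'a \<Rightarrow> ennreal" assume [measurable]: "g \<in> borel_measurable borel"
  let ?d = "DIM('a)"
  \<comment> \<open>What the last scaling, by \<open>norm v ^ 2\<close>, leaves over; at this point
    it is just an extended nonnegative constant.\<close>
  let ?C = "\<integral>\<^sup>+u. (if 1 < norm u then ennreal (1 / norm u ^ (2 * ?d)) else 0) \<partial>(lborel :: 'a measure)"
  have pos: "AE x in lborel. 0 < norm (x :: 'a)"
    using AE_lborel_singleton[of "0 :: 'a"] by eventually_elim simp
  \<comment> \<open>The origin is a null set, so the integrands have to agree only at nonzero
    points, whose norms can serve as scaling factors.\<close>
  have cong: "(\<integral>\<^sup>+x. F x \<partial>lborel) = (\<integral>\<^sup>+x. H x \<partial>lborel)"
    if "\<And>x :: 'a. 0 < norm x \<Longrightarrow> F x = H x" for F H :: "'a \<Rightarrow> ennreal"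
    using pos that by (intro nn_integral_cong_AE) (auto elim: eventually_mono)
  have "(\<integral>\<^sup>+x. \<integral>\<^sup>+y. (if norm y < 1 then g (norm x *\<^sub>R sgn y) else 0) \<partial>lborel \<partial>(lborel :: 'a measure)) =
      (\<integral>\<^sup>+x. \<integral>\<^sup>+z. (if norm x * norm z < 1 then ennreal (norm x ^ ?d) * g (norm x *\<^sub>R sgn z) else 0) \<partial>lborel \<partial>(lborel :: 'a measure))"
  proof (rule cong)
    fix x :: 'a assume x: "0 < norm x"
    show "(\<integral>\<^sup>+y. (if norm y < 1 then g (norm x *\<^sub>R sgn y) else 0) \<partial>lborel) =
        (\<integral>\<^sup>+z. (if norm x * norm z < 1 then ennreal (norm x ^ ?d) * g (norm x *\<^sub>R sgn z) else 0) \<partial>lborel)"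
    proof -
      have "(\<lambda>y. (if norm y < 1 then g (norm x *\<^sub>R sgn y) else 0)) \<in> borel_measurable borel"
        by measurable
      then show ?thesis
        using x by (subst nn_integral_lborel_scaleR[of _ "norm x"])
          (auto simp: sgn_scaleR_pos indicator_def intro!: nn_integral_cong)
    qed
  qed
  also have "\<dots> = (\<integral>\<^sup>+z. \<integral>\<^sup>+x. (if norm x * norm z < 1 then ennreal (norm x ^ ?d) * g (norm x *\<^sub>R sgn z) else 0) \<partial>(lborel :: 'a measure) \<partial>lborel)"
    by (rule nn_integral_lborel_swap) measurable
  also have "\<dots> = (\<integral>\<^sup>+z. \<integral>\<^sup>+w. (if norm w * norm z ^ 2 < 1
      then ennreal (norm z ^ ?d) * (ennreal ((norm z * norm w) ^ ?d) * g (norm w *\<^sub>R z)) else 0) \<partial>(lborel :: 'a measure) \<partial>(lborel :: 'a measure))"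
  proof (rule cong)
    fix z :: 'a assume z: "0 < norm z"
    have *: "(norm w * norm z) *\<^sub>R sgn z = norm w *\<^sub>R z" for w :: 'a
      by (simp add: scaleR_norm_sgn flip: scaleR_scaleR)
    show "(\<integral>\<^sup>+x. (if norm x * norm z < 1 then ennreal (norm x ^ ?d) * g (norm x *\<^sub>R sgn z) else 0) \<partial>(lborel :: 'a measure)) =
       (\<integral>\<^sup>+w. (if norm w * norm z ^ 2 < 1
      then ennreal (norm z ^ ?d) * (ennreal ((norm z * norm w) ^ ?d) * g (norm w *\<^sub>R z)) else 0) \<partial>(lborel :: 'a measure))"
    proof -
      have "(\<lambda>x :: 'a. if norm x * norm z < 1 then ennreal (norm x ^ ?d) * g (norm x *\<^sub>R sgn z) else 0) \<in> borel_measurable borel"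
        by measurable
      then show ?thesis
        using z by (subst nn_integral_lborel_scaleR[of _ "norm z"])
          (auto simp: * power2_eq_square mult_ac intro!: nn_integral_cong)
    qed
  qed
  also have "\<dots> = (\<integral>\<^sup>+w. \<integral>\<^sup>+z. (if norm w * norm z ^ 2 < 1
      then ennreal (norm z ^ ?d) * (ennreal ((norm z * norm w) ^ ?d) * g (norm w *\<^sub>R z)) else 0) \<partial>(lborel :: 'a measure) \<partial>(lborel :: 'a measure))"
    by (rule nn_integral_lborel_swap) measurable
  also have "\<dots> = (\<integral>\<^sup>+w. \<integral>\<^sup>+v. (if norm v ^ 2 < norm w
      then ennreal (norm v ^ (2 * ?d) / norm w ^ (2 * ?d)) * g v else 0) \<partial>(lborel :: 'a measure) \<partial>(lborel :: 'a measure))"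
  proof (rule cong)
    fix w :: 'a assume w: "0 < norm w"
    show "(\<integral>\<^sup>+z. (if norm w * norm z ^ 2 < 1
      then ennreal (norm z ^ ?d) * (ennreal ((norm z * norm w) ^ ?d) * g (norm w *\<^sub>R z)) else 0) \<partial>(lborel :: 'a measure)) =
       (\<integral>\<^sup>+v. (if norm v ^ 2 < norm w
      then ennreal (norm v ^ (2 * ?d) / norm w ^ (2 * ?d)) * g v else 0) \<partial>(lborel :: 'a measure))"
    proof -
      have meas: "(\<lambda>z. if norm w * norm z ^ 2 < 1
          then ennreal (norm z ^ ?d) * (ennreal ((norm z * norm w) ^ ?d) * g (norm w *\<^sub>R z)) else 0) \<in> borel_measurable borel"
        by measurable
      have eq: "ennreal (\<bar>1 / norm w\<bar> ^ ?d) * (ennreal (norm ((1 / norm w) *\<^sub>R v) ^ ?d) *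
          (ennreal ((norm ((1 / norm w) *\<^sub>R v) * norm w) ^ ?d) * g (norm w *\<^sub>R (1 / norm w) *\<^sub>R v))) =
          ennreal (norm v ^ (2 * ?d) / norm w ^ (2 * ?d)) * g v" for v :: 'a
      proof -
        have "\<bar>1 / norm w\<bar> ^ ?d * (norm ((1 / norm w) *\<^sub>R v) ^ ?d * (norm ((1 / norm w) *\<^sub>R v) * norm w) ^ ?d) =
            norm v ^ (2 * ?d) / norm w ^ (2 * ?d)"
          using w by (simp add: power_mult_distrib power_divide mult_2 power_add)
        then show ?thesis
          using w by (simp add: ennreal_mult[symmetric] mult.assoc[symmetric])
      qed
      have iff: "norm w * (norm ((1 / norm w) *\<^sub>R v))\<^sup>2 < 1 \<longleftrightarrow> norm v ^ 2 < norm w" for v :: 'a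
        using w by (simp add: field_simps power2_eq_square)
      show ?thesis
        using w by (subst nn_integral_lborel_scaleR[OF meas, of "1 / norm w"], force)
          (auto simp only: iff eq if_distrib[of "(*) _"] mult_zero_right cong: if_cong)
    qed
  qed
  also have "\<dots> = (\<integral>\<^sup>+v. \<integral>\<^sup>+w. (if norm v ^ 2 < norm w
      then ennreal (norm v ^ (2 * ?d) / norm w ^ (2 * ?d)) * g v else 0) \<partial>(lborel :: 'a measure) \<partial>(lborel :: 'a measure))"
    by (rule nn_integral_lborel_swap) measurable
  also have "\<dots> = (\<integral>\<^sup>+v. ?C * g v \<partial>(lborel :: 'a measure))"
  proof (rule cong)
    fix v :: 'a assume v: "0 < norm v"
    show "(\<integral>\<^sup>+w. (if norm v ^ 2 < norm w
      then ennreal (norm v ^ (2 * ?d) / norm w ^ (2 * ?d)) * g v else 0) \<partial>(lborel :: 'a measure)) = ?C * g v"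
    proof -
      have meas: "(\<lambda>w :: 'a. if norm v ^ 2 < norm w
          then ennreal (norm v ^ (2 * ?d) / norm w ^ (2 * ?d)) * g v else 0) \<in> borel_measurable borel"
        by measurable
      have eq: "ennreal (\<bar>norm v ^ 2\<bar> ^ ?d) * (ennreal (norm v ^ (2 * ?d) / norm ((norm v ^ 2) *\<^sub>R u) ^ (2 * ?d)) * g v) =
          ennreal (1 / norm u ^ (2 * ?d)) * g v" if "1 < norm u" for u :: 'a
      proof -
        have "\<bar>norm v ^ 2\<bar> ^ ?d * (norm v ^ (2 * ?d) / norm ((norm v ^ 2) *\<^sub>R u) ^ (2 * ?d)) = 1 / norm u ^ (2 * ?d)"
          using v that by (simp add: power_mult_distrib mult_2 power_add power2_eq_square)
        then show ?thesis
          by (simp add: ennreal_mult[symmetric] mult.assoc[symmetric])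
      qed
      have iff: "norm v ^ 2 < norm ((norm v ^ 2) *\<^sub>R u) \<longleftrightarrow> 1 < norm u" for u :: 'a
        using v by simp
      have "(\<integral>\<^sup>+w. (if norm v ^ 2 < norm w then ennreal (norm v ^ (2 * ?d) / norm w ^ (2 * ?d)) * g v else 0)
          \<partial>(lborel :: 'a measure)) = (\<integral>\<^sup>+u. (if 1 < norm u then ennreal (1 / norm u ^ (2 * ?d)) else 0) * g v \<partial>(lborel :: 'a measure))"
        using v by (subst nn_integral_lborel_scaleR[OF meas, of "norm v ^ 2"], force)
          (auto simp only: iff eq mult_zero_right mult_zero_left split: if_split intro!: nn_integral_cong)
      also have "\<dots> = ?C * g v" by (rule nn_integral_multc) measurable
      finally show ?thesis .
    qed
  qed
  also have "\<dots> = ?C * (\<integral>\<^sup>+v. g v \<partial>lborel)"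
    by (rule nn_integral_cmult) measurable
  finally show "(\<integral>\<^sup>+x. \<integral>\<^sup>+y. (if norm y < 1 then g (norm x *\<^sub>R sgn y) else 0) \<partial>lborel \<partial>(lborel :: 'a measure)) = ?C * (\<integral>\<^sup>+v. g v \<partial>lborel)" .
qed

lemma nn_integral_directions:
  fixes g :: "'a::euclidean_space \<Rightarrow> ennreal"
  assumes "g \<in> borel_measurable borel"
  shows "(\<integral>\<^sup>+x. \<integral>\<^sup>+y. (if norm y < 1 then g (norm x *\<^sub>R sgn y) else 0) \<partial>lborel \<partial>(lborel :: 'a measure)) =
    emeasure lborel (ball (0 :: 'a) 1) * (\<integral>\<^sup>+x. g x \<partial>lborel)"
proof -
  obtain C where C: "\<And>g :: 'a::euclidean_space \<Rightarrow> ennreal. g \<in> borel_measurable borel \<Longrightarrow>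
    (\<integral>\<^sup>+x. \<integral>\<^sup>+y. (if norm y < 1 then g (norm x *\<^sub>R sgn y) else 0) \<partial>lborel \<partial>(lborel :: 'a measure)) = C * (\<integral>\<^sup>+x. g x \<partial>lborel)"
    using nn_integral_directions_eq_cmult by blast
  let ?B = "ball (0 :: 'a) 1"
  have [measurable]: "?B \<in> sets borel" by simp
  have "C * emeasure lborel ?B = C * (\<integral>\<^sup>+x. indicator ?B x \<partial>lborel)" by simp
  also have "\<dots> = (\<integral>\<^sup>+x. \<integral>\<^sup>+y. (if norm y < 1 then indicator ?B (norm x *\<^sub>R sgn y) else 0) \<partial>lborel \<partial>(lborel :: 'a measure))"
    by (rule C[symmetric]) simp
  \<comment> \<open>For nonzero \<open>y\<close> the point \<open>norm x *\<^sub>R sgn y\<close> has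
    norm \<open>norm x\<close>, so the integrand splits into a product almost everywhere.\<close>
  also have "\<dots> = (\<integral>\<^sup>+x. \<integral>\<^sup>+y. indicator ?B x * indicator ?B y \<partial>lborel \<partial>lborel)"
  proof (rule nn_integral_cong, rule nn_integral_cong_AE)
    fix x :: 'a
    show "AE y in lborel. (if norm y < 1 then indicator ?B (norm x *\<^sub>R sgn y) else 0) = (indicator ?B x * indicator ?B y :: ennreal)"
      using AE_lborel_singleton[of "0 :: 'a"]
      by eventually_elim (auto simp: indicator_def norm_sgn)
  qed
  also have "\<dots> = emeasure lborel ?B * emeasure lborel ?B"
    by (simp add: nn_integral_cmult nn_integral_multc)
  finally have eq: "emeasure lborel ?B * C = emeasure lborel ?B * emeasure lborel ?B"
    by (simp add: mult.commute)
  \<comment> \<open>The volume of the ball is finite and nonzero, hence can be cancelled in the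
    extended nonnegative reals.\<close>
  have fin: "emeasure lborel ?B \<noteq> top"
    using emeasure_lborel_ball_finite[of "0 :: 'a" 1] by (simp only: infinity_ennreal_def less_top)
  have "measure lborel ?B \<noteq> 0"
    using content_ball_pos[of 1 "0 :: 'a"] by simp
  then have "emeasure lborel ?B \<noteq> 0"
    by (auto simp: measure_def)
  then have "C = emeasure lborel ?B"
    using eq fin by (simp add: ennreal_mult_cancel_left)
  then show ?thesis using C[OF assms] by simp
qed

section \<open>Spherical means as averages over the punctured ball\<close>

abbreviation punctured_unit_ball :: "'a::euclidean_space measure" where
  "punctured_unit_ball \<equiv> restrict_space lborel (ball 0 1 - {0})"

lemma emeasure_punctured_unit_ball:
  "emeasure punctured_unit_ball (ball 0 1 - {0 :: 'a::euclidean_space}) = emeasure lborel (ball (0 :: 'a) 1)"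
  by (subst emeasure_restrict_space) (auto simp: emeasure_Diff)

lemma measure_punctured_unit_ball:
  "measure punctured_unit_ball (ball 0 1 - {0 :: 'a::euclidean_space}) = measure lborel (ball (0 :: 'a) 1)"
  by (simp add: measure_def emeasure_punctured_unit_ball)

lemma finite_measure_punctured_unit_ball:
  "finite_measure (punctured_unit_ball :: 'a::euclidean_space measure)"
proof (rule finite_measureI)
  show "emeasure punctured_unit_ball (space (punctured_unit_ball :: 'a measure)) \<noteq> \<infinity>"
    using emeasure_lborel_ball_finite[of "0 :: 'a" 1]
    by (simp add: space_restrict_space emeasure_punctured_unit_ball)
qed

lemma sgn_measurable_punctured_unit_ball [measurable]:
  "sgn \<in> (punctured_unit_ball :: 'a::euclidean_space measure) \<rightarrow>\<^sub>M borel"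
  by (rule sgn_measurable_punctured_ball)

text \<open>Polar coordinates as an identity of measures, obtained from
  \<open>nn_integral_directions\<close> on indicator functions. In this form integrals of complex
  functions can be transferred as well.\<close>

lemma distr_directions:
  "distr (lborel \<Otimes>\<^sub>M punctured_unit_ball) borel (\<lambda>(x :: 'a::euclidean_space, y :: 'a). norm x *\<^sub>R sgn y) =
    density lborel (\<lambda>_. ennreal (measure lborel (ball (0 :: 'a) 1)))"
proof (rule measure_eqI)
  interpret M: finite_measure "punctured_unit_ball :: 'a measure"
    by (rule finite_measure_punctured_unit_ball)
  let ?T = "\<lambda>(x :: 'a, y :: 'a). norm x *\<^sub>R sgn y"
  have T [measurable]: "?T \<in> lborel \<Otimes>\<^sub>M punctured_unit_ball \<rightarrow>\<^sub>M borel"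
    by measurable
  fix A assume "A \<in> sets (distr (lborel \<Otimes>\<^sub>M punctured_unit_ball) borel ?T)"
  then have [measurable]: "A \<in> sets borel" by simp
  have "emeasure (distr (lborel \<Otimes>\<^sub>M punctured_unit_ball) borel ?T) A =
      (\<integral>\<^sup>+p. indicator A (?T p) \<partial>(lborel \<Otimes>\<^sub>M punctured_unit_ball))"
    by (subst nn_integral_distr[symmetric, OF T]) auto
  also have "\<dots> = (\<integral>\<^sup>+x. \<integral>\<^sup>+y. indicator A (norm x *\<^sub>R sgn y) \<partial>punctured_unit_ball \<partial>(lborel :: 'a measure))"
    by (subst M.nn_integral_fst[symmetric]) auto
  also have "\<dots> = (\<integral>\<^sup>+x. \<integral>\<^sup>+y. (if norm y < 1 then indicator A (norm x *\<^sub>R sgn y) else 0) \<partial>lborel \<partial>(lborel :: 'a measure))"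
  proof (rule nn_integral_cong)
    fix x :: 'a
    have "(\<integral>\<^sup>+y. indicator A (norm x *\<^sub>R sgn y) \<partial>punctured_unit_ball) =
      (\<integral>\<^sup>+y. indicator A (norm x *\<^sub>R sgn y) * indicator (ball 0 1 - {0}) y \<partial>lborel)"
      by (rule nn_integral_restrict_space) simp
    also have "\<dots> = (\<integral>\<^sup>+y. (if norm y < 1 then indicator A (norm x *\<^sub>R sgn y) else 0) \<partial>lborel)"
      using AE_lborel_singleton[of "0 :: 'a"]
      by (intro nn_integral_cong_AE) (auto elim!: eventually_mono simp: indicator_def)
    finally show "(\<integral>\<^sup>+y. indicator A (norm x *\<^sub>R sgn y) \<partial>punctured_unit_ball) =
      (\<integral>\<^sup>+y. (if norm y < 1 then indicator A (norm x *\<^sub>R sgn y) else 0) \<partial>lborel)" .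
  qed
  also have "\<dots> = emeasure lborel (ball (0 :: 'a) 1) * (\<integral>\<^sup>+x. indicator A x \<partial>lborel)"
    by (rule nn_integral_directions) simp
  also have "emeasure lborel (ball (0 :: 'a) 1) = ennreal (measure lborel (ball (0 :: 'a) 1))"
    using emeasure_lborel_ball_finite[of "0 :: 'a" 1] by (simp add: emeasure_eq_ennreal_measure)
  finally show "emeasure (distr (lborel \<Otimes>\<^sub>M punctured_unit_ball) borel ?T) A =
      emeasure (density lborel (\<lambda>_. ennreal (measure lborel (ball (0 :: 'a) 1)))) A"
    by (simp add: emeasure_density_const)
qed simp

lemma sphere_area_eq_content_ball:
  "sphere_area TYPE('a::euclidean_space) = real DIM('a) * measure lborel (ball (0 :: 'a) 1)"
proof -
  have "real DIM('a) / 2 > 0" by simp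
  then have *: "Gamma (real DIM('a) / 2 + 1) = real DIM('a) / 2 * Gamma (real DIM('a) / 2)"
    by (intro Gamma_plus1) auto
  show ?thesis
    by (simp add: content_ball unit_ball_vol_def sphere_area_def * del: Gamma_plus1)
qed

lemma integral_sphere_measure:
  fixes g :: "'a::euclidean_space \<Rightarrow> complex"
  assumes [measurable]: "g \<in> borel_measurable borel"
  shows "(LINT \<theta>|sphere_measure. g \<theta>) = real DIM('a) *\<^sub>R (LINT y|punctured_unit_ball. g (sgn y))"
proof -
  \<comment> \<open>The scaling of the measure is rewritten as a constant density and so becomes a
    factor of the integrand.\<close>
  have *: "(sphere_measure :: 'a measure) = density (distr (punctured_unit_ball :: 'a measure) borel sgn) (\<lambda>_. ennreal (real DIM('a)))"
    unfolding sphere_measure_def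
    by (rule measure_eqI) (auto simp: emeasure_density_const ennreal_of_nat_eq_real_of_nat)
  have "(LINT \<theta>|sphere_measure. g \<theta>) = (LINT \<theta>|distr (punctured_unit_ball :: 'a measure) borel sgn. real DIM('a) *\<^sub>R g \<theta>)"
    unfolding * by (subst integral_density) auto
  also have "\<dots> = (LINT y|punctured_unit_ball. real DIM('a) *\<^sub>R g (sgn y))"
    by (rule integral_distr) auto
  finally show ?thesis by simp
qed

text \<open>The factor \<open>DIM('a)\<close> in the area cancels the one in the sphere measure,
  leaving an average over the directions of the points of the ball.\<close>

lemma spherical_mean_eq:
  fixes \<phi> :: "'a::euclidean_space \<Rightarrow> complex"
  assumes [measurable]: "\<phi> \<in> borel_measurable borel"
  shows "spherical_mean \<phi> r =
    (1 / measure lborel (ball (0 :: 'a) 1)) *\<^sub>R (LINT y|punctured_unit_ball. \<phi> (r *\<^sub>R sgn y))"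
proof -
  have "(LINT \<theta>|sphere_measure. \<phi> (r *\<^sub>R \<theta>)) = real DIM('a) *\<^sub>R (LINT y|punctured_unit_ball. \<phi> (r *\<^sub>R sgn y))"
    by (rule integral_sphere_measure) measurable
  then show ?thesis
    unfolding spherical_mean_def sphere_area_eq_content_ball by (simp add: scaleR_conv_of_real)
qed

text \<open>By Fubini the left side is an integral of \<open>\<phi>\<close> against the image
  measure of \<open>distr_directions\<close>, whose constant density cancels the normalization of
  the spherical mean.\<close>

lemma integral_radial_component_fun:
  fixes \<phi> :: "'a::euclidean_space \<Rightarrow> complex"
  assumes \<phi>: "integrable lborel \<phi>"
  shows "(LINT x|lborel. radial_component_fun \<phi> x) = (LINT x|lborel. \<phi> x)"
proof -
  let ?V = "measure lborel (ball (0 :: 'a) 1)"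
  have V: "0 < ?V" using content_ball_pos[of 1 "0 :: 'a"] by simp
  interpret M: finite_measure "punctured_unit_ball :: 'a measure"
    by (rule finite_measure_punctured_unit_ball)
  interpret P: pair_sigma_finite "lborel :: 'a measure" "punctured_unit_ball :: 'a measure" ..
  let ?T = "\<lambda>(x :: 'a, y :: 'a). norm x *\<^sub>R sgn y"
  have T [measurable]: "?T \<in> lborel \<Otimes>\<^sub>M punctured_unit_ball \<rightarrow>\<^sub>M borel"
    by measurable
  have [measurable]: "\<phi> \<in> borel_measurable borel" using \<phi> by simp
  \<comment> \<open>Integrability is pulled back from the image measure to the product, which
    justifies Fubini.\<close>
  have "integrable (distr (lborel \<Otimes>\<^sub>M punctured_unit_ball) borel ?T) \<phi>"
    unfolding distr_directions using \<phi> by (subst integrable_density) auto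
  then have int: "integrable (lborel \<Otimes>\<^sub>M punctured_unit_ball) (\<lambda>p. \<phi> (?T p))"
    by (rule integrable_distr[OF T])
  have "(LINT x|lborel. radial_component_fun \<phi> x) =
      (LINT x|lborel. (1 / ?V) *\<^sub>R (LINT y|punctured_unit_ball. \<phi> (norm (x :: 'a) *\<^sub>R sgn y)))"
    by (simp add: radial_component_fun_def spherical_mean_eq)
  also have "\<dots> = (1 / ?V) *\<^sub>R (LINT x|lborel. LINT y|punctured_unit_ball. \<phi> (?T (x, y)))"
    by simp
  also have "(LINT x|lborel. LINT y|punctured_unit_ball. \<phi> (?T (x, y))) =
      integral\<^sup>L (lborel \<Otimes>\<^sub>M punctured_unit_ball) (\<lambda>p. \<phi> (?T p))"
    using P.integral_fst'[OF int] by simp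
  also have "\<dots> = integral\<^sup>L (distr (lborel \<Otimes>\<^sub>M punctured_unit_ball) borel ?T) \<phi>"
    by (rule integral_distr[symmetric]) auto
  also have "\<dots> = ?V *\<^sub>R (LINT x|lborel. \<phi> x)"
    unfolding distr_directions by (subst integral_density) auto
  finally show ?thesis using V by simp
qed

text \<open>Directions have norm 1, so the dilation integral is smooth and vanishes as soon as
  \<open>\<bar>r\<bar>\<close> leaves the support radius of \<open>\<phi>\<close>. Evenness comes
  from the reflection of \<open>y\<close>.\<close>

lemma even_test_function_spherical_mean:
  fixes \<phi> :: "'a::euclidean_space \<Rightarrow> complex"
  assumes \<phi>: "test_function \<phi>"
  shows "even_test_function (spherical_mean \<phi>)"
proof -
  have [measurable]: "\<phi> \<in> borel_measurable borel"
    using \<phi> by (rule test_function_borel_measurable)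
  let ?c = "1 / measure lborel (ball (0 :: 'a) 1)"
  let ?I = "\<lambda>r. LINT y|punctured_unit_ball. (1 :: real) *\<^sub>R \<phi> (r *\<^sub>R sgn y)"
  have eq: "spherical_mean \<phi> = (\<lambda>r. ?c *\<^sub>R ?I r)"
    by (auto simp: spherical_mean_eq)
  have "smooth ?I"
    by (rule smooth_dilation_integral[OF finite_measure_punctured_unit_ball _ _ _ _ \<phi>, where A = 1])
      (auto simp: norm_sgn)
  moreover obtain R where R: "0 < R" "\<And>x. R < norm x \<Longrightarrow> \<phi> x = 0" using test_functionE[OF \<phi>] by blast
  have "?I r = 0" if "R < norm r" for r
  proof -
    have "?I r = (LINT y|(punctured_unit_ball :: 'a measure). 0)"
      using R that by (intro Bochner_Integration.integral_cong) (auto simp: space_restrict_space norm_sgn)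
    then show ?thesis by simp
  qed
  ultimately have "test_function ?I" by (intro test_functionI[of ?I R]) auto
  then have "test_function (spherical_mean \<phi>)"
    unfolding eq by (rule test_function_bounded_linear[OF _ bounded_linear_scaleR_right])
  moreover have "?I (- r) = ?I r" for r
  proof -
    have restr: "?I r = (LINT y|lborel. indicator (ball 0 1 - {0}) y *\<^sub>R \<phi> (r *\<^sub>R sgn y))" for r
      by (subst integral_restrict_space) auto
    \<comment> \<open>Lebesgue measure is invariant under scaling by \<open>- 1\<close>, the
      punctured ball is symmetric and \<open>sgn\<close> is odd.\<close>
    have "(LINT y|lborel. indicator (ball 0 1 - {0}) y *\<^sub>R \<phi> (r *\<^sub>R sgn y)) =
        (LINT y|lborel. indicator (ball 0 1 - {0}) y *\<^sub>R \<phi> ((- r) *\<^sub>R sgn y))"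
      by (subst integral_lborel_scaleR[of _ "- 1"]) (auto simp: indicator_def sgn_minus)
    then show ?thesis unfolding restr by (rule sym)
  qed
  ultimately show ?thesis
    unfolding even_test_function_def eq by simp
qed

section \<open>A smooth bump\<close>

text \<open>The case \<open>k = 0\<close> is the classical flat function
  \<open>exp (- (1 / t))\<close> extended by 0. The powers of \<open>1 / t\<close> are those that
  differentiation produces; they make the family closed under it up to linear combinations.\<close>

definition flat_exp :: "nat \<Rightarrow> real \<Rightarrow> real" where
  "flat_exp k t = (if 0 < t then (1 / t) ^ k * exp (- (1 / t)) else 0)"

text \<open>With \<open>u = 1 / t\<close> the right-hand limit becomes that of
  \<open>u ^ k / exp u\<close> at infinity.\<close>

lemma flat_exp_tendsto_0: "(flat_exp k \<longlongrightarrow> 0) (at 0)"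
proof (rule filterlim_split_at)
  show "(flat_exp k \<longlongrightarrow> 0) (at_left 0)"
    by (rule tendsto_eventually) (auto simp: eventually_at_filter flat_exp_def)
  have "((\<lambda>t. inverse t ^ k / exp (inverse t)) \<longlongrightarrow> 0) (at_right (0::real))"
    by (rule filterlim_compose[OF tendsto_power_div_exp_0 filterlim_inverse_at_top_right])
  moreover have "\<forall>\<^sub>F t in at_right 0. inverse t ^ k / exp (inverse t) = flat_exp k t"
    by (auto simp: eventually_at_filter flat_exp_def exp_minus field_simps)
  ultimately show "(flat_exp k \<longlongrightarrow> 0) (at_right 0)"
    by (rule Lim_transform_eventually)
qed

lemma flat_exp_has_derivative:
  "(flat_exp k has_real_derivative flat_exp (k + 2) t - real k * flat_exp (k + 1) t) (at t)"
proof (cases t "0 :: real" rule: linorder_cases)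
  case less
  have "((\<lambda>_. 0) has_real_derivative 0) (at t)" by simp
  then have "(flat_exp k has_real_derivative 0) (at t)"
    by (rule has_field_derivative_transform_within_open[where S = "{..<0}"])
      (use less in \<open>auto simp: flat_exp_def\<close>)
  then show ?thesis using less by (simp add: flat_exp_def)
next
  case equal
  \<comment> \<open>At 0 the difference quotient of member \<open>k\<close> is member
    \<open>k + 1\<close>, which tends to 0.\<close>
  have "(\<lambda>h. (flat_exp k (0 + h) - flat_exp k 0) / h) \<midarrow>0\<rightarrow> 0"
  proof (rule Lim_transform_eventually[OF flat_exp_tendsto_0[of "k + 1"]])
    show "\<forall>\<^sub>F h in at 0. flat_exp (k + 1) h = (flat_exp k (0 + h) - flat_exp k 0) / h"
      by (auto simp: flat_exp_def eventually_at_filter field_simps)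
  qed
  then show ?thesis using equal by (simp add: DERIV_def flat_exp_def)
next
  case greater
  have "((\<lambda>t. (1 / t) ^ k * exp (- (1 / t))) has_real_derivative
      flat_exp (k + 2) t - real k * flat_exp (k + 1) t) (at t)"
  proof -
    have *: "((\<lambda>t. 1 / t) has_real_derivative (- ((1 / t) ^ 2))) (at t)"
      using greater by (auto intro!: derivative_eq_intros simp: power2_eq_square)
    have "((\<lambda>t. (1 / t) ^ k * exp (- (1 / t))) has_real_derivative
        (real k * (- ((1 / t) ^ 2) * (1 / t) ^ (k - Suc 0))) * exp (- (1 / t)) +
        exp (- (1 / t)) * (- (- ((1 / t) ^ 2))) * (1 / t) ^ k) (at t)"
      by (intro DERIV_mult DERIV_power DERIV_fun_exp DERIV_minus *)
    \<comment> \<open>For \<open>k = 0\<close> the exponent \<open>k - Suc 0\<close> is truncated,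
      but the factor \<open>real k\<close> is then 0.\<close>
    moreover have eq: "real k * (- ((1 / t) ^ 2) * (1 / t) ^ (k - Suc 0)) = - (real k * (1 / t) ^ (k + 1))"
      by (cases k) (simp_all add: power2_eq_square)
    have "(real k * (- ((1 / t) ^ 2) * (1 / t) ^ (k - Suc 0))) * exp (- (1 / t)) +
        exp (- (1 / t)) * (- (- ((1 / t) ^ 2))) * (1 / t) ^ k = flat_exp (k + 2) t - real k * flat_exp (k + 1) t"
      unfolding eq using greater by (simp add: flat_exp_def power_add power2_eq_square mult_ac)
    ultimately show ?thesis by (simp only:)
  qed
  then show ?thesis
    by (rule has_field_derivative_transform_within_open[where S = "{0<..}"])
      (use greater in \<open>auto simp: flat_exp_def\<close>)
qed

text \<open>Products of a smooth coefficient with \<open>flat_exp k (R\<^sup>2 - r\<^sup>2)\<close>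
  are closed under differentiation up to sums: the inner derivative \<open>- (2 * r)\<close> is
  absorbed into the coefficient.\<close>

lemma smooth_bump: "smooth (\<lambda>r::real. flat_exp 0 (R\<^sup>2 - r\<^sup>2))"
proof -
  define S where "S = {\<lambda>r::real. p r *\<^sub>R flat_exp k (R\<^sup>2 - r\<^sup>2) |p k. smooth (p :: real \<Rightarrow> real)}"
  have S: "(\<lambda>r. p r *\<^sub>R flat_exp k (R\<^sup>2 - r\<^sup>2)) \<in> S" if "smooth p" for p k
    unfolding S_def using that by (intro CollectI exI conjI) (rule refl)
  have "smooth (\<lambda>r::real. 1 *\<^sub>R flat_exp 0 (R\<^sup>2 - r\<^sup>2))"
  proof (rule smooth_coinduct_sum_list)
    show "(\<lambda>r::real. 1 *\<^sub>R flat_exp 0 (R\<^sup>2 - r\<^sup>2)) \<in> S" by (rule S[OF smooth_const])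
    fix g assume "g \<in> S"
    then obtain p k where g: "g = (\<lambda>r. p r *\<^sub>R flat_exp k (R\<^sup>2 - r\<^sup>2))" and p: "smooth (p :: real \<Rightarrow> real)"
      unfolding S_def by auto
    \<comment> \<open>\<open>r \<bullet> 1\<close> is \<open>r\<close> in the form covered by
      \<open>smooth_inner_left\<close>.\<close>
    let ?q = "\<lambda>c r. c *\<^sub>R (p r *\<^sub>R (r \<bullet> 1))"
    let ?hs = "\<lambda>v. [\<lambda>r. ?q (- 2 * v) r *\<^sub>R flat_exp (k + 2) (R\<^sup>2 - r\<^sup>2),
      \<lambda>r. ?q (2 * v * real k) r *\<^sub>R flat_exp (k + 1) (R\<^sup>2 - r\<^sup>2),
      \<lambda>r. frechet_derivative p (at r) v *\<^sub>R flat_exp k (R\<^sup>2 - r\<^sup>2)]"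
    have q: "smooth (?q c)" for c
      by (intro smooth_scaleR smooth_const smooth_inner_left p)
    show "\<exists>g'. (\<forall>x. (g has_derivative g' x) (at x)) \<and>
        (\<forall>v\<in>Basis. \<exists>hs. set hs \<subseteq> S \<and> (\<lambda>x. g' x v) = (\<lambda>x. \<Sum>h\<leftarrow>hs. h x))"
    proof (intro exI conjI allI ballI)
      fix r
      have "((\<lambda>r. R\<^sup>2 - r\<^sup>2) has_real_derivative (- (2 * r))) (at r)"
        by (auto intro!: derivative_eq_intros)
      from DERIV_chain2[OF flat_exp_has_derivative[of k] this]
      have der: "((\<lambda>r. flat_exp k (R\<^sup>2 - r\<^sup>2)) has_derivative
          (\<lambda>h. (flat_exp (k + 2) (R\<^sup>2 - r\<^sup>2) - real k * flat_exp (k + 1) (R\<^sup>2 - r\<^sup>2)) * (- (2 * r)) * h)) (at r)"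
        unfolding has_field_derivative_def .
      from has_derivative_scaleR[OF smooth_has_derivative[OF p] der]
      show "(g has_derivative (\<lambda>h. p r *\<^sub>R ((flat_exp (k + 2) (R\<^sup>2 - r\<^sup>2) - real k * flat_exp (k + 1) (R\<^sup>2 - r\<^sup>2)) * (- (2 * r)) * h) +
          frechet_derivative p (at r) h *\<^sub>R flat_exp k (R\<^sup>2 - r\<^sup>2))) (at r)"
        unfolding g .
    next
      fix v :: real assume v: "v \<in> Basis"
      show "set (?hs v) \<subseteq> S"
        by (simp only: list.set insert_subset empty_subsetI S[OF q] S[OF smooth_partial[OF p v]] simp_thms)
      show "(\<lambda>r. p r *\<^sub>R ((flat_exp (k + 2) (R\<^sup>2 - r\<^sup>2) - real k * flat_exp (k + 1) (R\<^sup>2 - r\<^sup>2)) * (- (2 * r)) * v) +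
          frechet_derivative p (at r) v *\<^sub>R flat_exp k (R\<^sup>2 - r\<^sup>2)) = (\<lambda>r. \<Sum>h\<leftarrow>?hs v. h r)"
        by (simp add: algebra_simps)
    qed
  qed
  then show ?thesis by simp
qed

lemma even_test_function_bump: "even_test_function (\<lambda>r. complex_of_real (flat_exp 0 (R\<^sup>2 - r\<^sup>2)))"
proof -
  have "test_function (\<lambda>r. complex_of_real (flat_exp 0 (R\<^sup>2 - r\<^sup>2)))"
  proof (rule test_functionI[of _ "\<bar>R\<bar>"])
    show "smooth (\<lambda>r. complex_of_real (flat_exp 0 (R\<^sup>2 - r\<^sup>2)))"
      by (rule smooth_bounded_linear[OF smooth_bump bounded_linear_of_real])
    fix r :: real assume "\<bar>R\<bar> < norm r"
    then have "R\<^sup>2 < r\<^sup>2" by (simp add: abs_less_iff power2_strict_mono)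
    then show "complex_of_real (flat_exp 0 (R\<^sup>2 - r\<^sup>2)) = 0" by (simp add: flat_exp_def)
  qed
  then show ?thesis by (simp add: even_test_function_def)
qed

section \<open>Limits of radial dilations\<close>

lemma radial_iff:
  "radial \<phi> \<longleftrightarrow> (\<exists>\<psi>. even_test_function \<psi> \<and> \<phi> = (\<lambda>x. \<psi> (norm x)))"
  unfolding radial_def even_test_function_def by (auto simp: fun_eq_iff)

lemma radialI: "even_test_function \<psi> \<Longrightarrow> radial (\<lambda>x. \<psi> (norm x))"
  unfolding radial_iff by blast

lemma test_function_radial: "radial \<phi> \<Longrightarrow> test_function \<phi>"
  using test_function_compose_norm by (auto simp: radial_iff)

lemma radial_radial_component_fun: "test_function \<phi> \<Longrightarrow> radial (radial_component_fun \<phi>)"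
  using even_test_function_spherical_mean unfolding radial_iff radial_component_fun_def by blast

lemma radial_component_fun_radial:
  fixes \<phi> :: "'a::euclidean_space \<Rightarrow> complex"
  assumes "radial \<phi>"
  shows "radial_component_fun \<phi> = \<phi>"
proof
  fix x :: 'a
  obtain \<psi> where \<psi>: "\<phi> = (\<lambda>x. \<psi> (norm x))" using assms radial_iff by blast
  let ?V = "measure lborel (ball (0 :: 'a) 1)"
  have V: "0 < ?V" using content_ball_pos[of 1 "0 :: 'a"] by simp
  have "(LINT y|(punctured_unit_ball :: 'a measure). \<phi> (norm x *\<^sub>R sgn y)) = (LINT y|(punctured_unit_ball :: 'a measure). \<phi> x)"
    by (intro Bochner_Integration.integral_cong) (auto simp: space_restrict_space norm_sgn \<psi>)
  also have "\<dots> = ?V *\<^sub>R \<phi> x"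
    by (simp add: space_restrict_space measure_punctured_unit_ball)
  finally have "(LINT y|(punctured_unit_ball :: 'a measure). \<phi> (norm x *\<^sub>R sgn y)) = ?V *\<^sub>R \<phi> x" .
  moreover have "\<phi> \<in> borel_measurable borel"
    using assms by (intro test_function_borel_measurable test_function_radial)
  ultimately show "radial_component_fun \<phi> x = \<phi> x"
    using V by (simp add: radial_component_fun_def spherical_mean_eq)
qed

text \<open>For negative \<open>c\<close> the spherical mean is evaluated at a negative radius; its
  evenness removes the sign.\<close>

lemma radial_component_fun_dilation:
  fixes \<phi> :: "'a::euclidean_space \<Rightarrow> complex"
  assumes "test_function \<phi>"
  shows "radial_component_fun (\<lambda>y. \<phi> (c *\<^sub>R y)) x = radial_component_fun \<phi> (\<bar>c\<bar> *\<^sub>R x)"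
proof -
  have "spherical_mean (\<lambda>y. \<phi> (c *\<^sub>R y)) (norm x) = spherical_mean \<phi> (c * norm x)"
    by (simp add: spherical_mean_def mult.commute)
  also have "\<dots> = spherical_mean \<phi> (\<bar>c\<bar> * norm x)"
    using even_test_function_spherical_mean[OF assms] unfolding even_test_function_def abs_real_def by simp
  finally show ?thesis by (simp add: radial_component_fun_def)
qed

text \<open>The substitution \<open>t = 1 / \<bar>\<epsilon>\<bar>\<close> turns the limit at 0 into
  one at infinity. At \<open>\<epsilon> = 0\<close> both sides are 0, because
  \<open>inverse 0 = 0\<close> and the dimension is positive, so the identity holds for all
  \<open>\<epsilon>\<close>.\<close>

lemma affine_change_radial_component:
  fixes f :: "('a::euclidean_space \<Rightarrow> complex) \<Rightarrow> complex"
  assumes "test_function \<phi>"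
  shows "affine_change (radial_component (affine_change f x0 1)) 0 \<epsilon> \<phi> =
    dilated_pairing f x0 (radial_component_fun \<phi>) (inverse \<bar>\<epsilon>\<bar>)"
  using radial_component_fun_dilation[OF assms, of "inverse \<epsilon>"]
  by (simp add: affine_change_def radial_component_def dilated_pairing_def power_inverse divide_inverse)

text \<open>For positive \<open>n\<close> the dilate is a test function, so linearity of
  \<open>f\<close> moves the factor \<open>n ^ DIM('a)\<close> outside.\<close>

lemma affine_change_standard_delta_sequence:
  fixes f :: "('a::euclidean_space \<Rightarrow> complex) \<Rightarrow> complex"
  assumes "distribution f" "test_function \<phi>" "0 < n"
  shows "affine_change f x0 1 (standard_delta_sequence \<phi> n) = dilated_pairing f x0 \<phi> (real n)"
proof -
  have "f (\<lambda>y. of_nat n ^ DIM('a) * \<phi> (real n *\<^sub>R (y - x0))) =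
      of_nat n ^ DIM('a) * f (\<lambda>y. \<phi> (real n *\<^sub>R (y - x0)))"
    using assms test_function_dilation[of \<phi> "real n" x0] unfolding distribution_def by simp
  then show ?thesis
    by (simp add: affine_change_def standard_delta_sequence_def dilated_pairing_def)
qed

section \<open>The linear class of radial functions with the expected limit\<close>

definition radial_limit ::
  "(('a::euclidean_space \<Rightarrow> complex) \<Rightarrow> complex) \<Rightarrow> 'a \<Rightarrow> complex \<Rightarrow> ('a \<Rightarrow> complex) \<Rightarrow> bool" where
  "radial_limit f x0 \<gamma> \<phi> \<longleftrightarrow> radial \<phi> \<and>
    (dilated_pairing f x0 \<phi> \<longlongrightarrow> \<gamma> * (LINT x|lborel. \<phi> x)) at_top"

lemma radial_add:
  assumes "radial \<phi>" "radial \<psi>"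
  shows "radial (\<lambda>x. \<phi> x + \<psi> x)"
proof -
  obtain u v where u: "even_test_function u" "\<phi> = (\<lambda>x. u (norm x))"
    and v: "even_test_function v" "\<psi> = (\<lambda>x. v (norm x))"
    using assms radial_iff by blast
  have "even_test_function (\<lambda>r. u r + v r)"
    using u v by (simp add: even_test_function_def test_function_add)
  from radialI[OF this] show ?thesis unfolding u v .
qed

lemma radial_cmult:
  assumes "radial \<phi>"
  shows "radial (\<lambda>x. c * \<phi> x)"
proof -
  obtain u where u: "even_test_function u" "\<phi> = (\<lambda>x. u (norm x))"
    using assms radial_iff by blast
  have "even_test_function (\<lambda>r. c * u r)"
    using u by (simp add: even_test_function_def test_function_cmult)
  from radialI[OF this] show ?thesis unfolding u .
qed

lemma radial_limit_add:
  assumes f: "distribution f" and "radial_limit f x0 \<gamma> \<phi>" "radial_limit f x0 \<gamma> \<psi>"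
  shows "radial_limit f x0 \<gamma> (\<lambda>x. \<phi> x + \<psi> x)"
proof -
  have r: "radial \<phi>" "radial \<psi>" using assms by (auto simp: radial_limit_def)
  note t = r[THEN test_function_radial]
  have "((\<lambda>s. dilated_pairing f x0 \<phi> s + dilated_pairing f x0 \<psi> s) \<longlongrightarrow>
      \<gamma> * (LINT x|lborel. \<phi> x) + \<gamma> * (LINT x|lborel. \<psi> x)) at_top"
    using assms unfolding radial_limit_def by (intro tendsto_add) auto
  also have "\<gamma> * (LINT x|lborel. \<phi> x) + \<gamma> * (LINT x|lborel. \<psi> x) = \<gamma> * (LINT x|lborel. \<phi> x + \<psi> x)"
    using t[THEN test_function_integrable] by (simp add: distrib_left)
  \<comment> \<open>Additivity of \<open>f\<close> is available for positive parameters, where the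
    dilates are test functions, hence eventually.\<close>
  finally have "(dilated_pairing f x0 (\<lambda>x. \<phi> x + \<psi> x) \<longlongrightarrow> \<gamma> * (LINT x|lborel. \<phi> x + \<psi> x)) at_top"
    by (rule Lim_transform_eventually)
      (use eventually_gt_at_top[of 0] in \<open>eventually_elim, simp add: dilated_pairing_add[OF f t]\<close>)
  then show ?thesis using radial_add[OF r] by (simp add: radial_limit_def)
qed

lemma radial_limit_cmult:
  assumes f: "distribution f" and "radial_limit f x0 \<gamma> \<phi>"
  shows "radial_limit f x0 \<gamma> (\<lambda>x. c * \<phi> x)"
proof -
  have r: "radial \<phi>" using assms by (auto simp: radial_limit_def)
  note t = test_function_radial[OF r]
  have "((\<lambda>s. c * dilated_pairing f x0 \<phi> s) \<longlongrightarrow> c * (\<gamma> * (LINT x|lborel. \<phi> x))) at_top"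
    using assms unfolding radial_limit_def by (intro tendsto_mult_left) auto
  also have "c * (\<gamma> * (LINT x|lborel. \<phi> x)) = \<gamma> * (LINT x|lborel. c * \<phi> x)"
    by simp
  finally have "(dilated_pairing f x0 (\<lambda>x. c * \<phi> x) \<longlongrightarrow> \<gamma> * (LINT x|lborel. c * \<phi> x)) at_top"
    by (rule Lim_transform_eventually)
      (use eventually_gt_at_top[of 0] in \<open>eventually_elim, simp add: dilated_pairing_cmult[OF f t]\<close>)
  then show ?thesis using radial_cmult[OF r] by (simp add: radial_limit_def)
qed

lemma radial_dilation:
  fixes \<phi> :: "'a::euclidean_space \<Rightarrow> complex"
  assumes "radial \<phi>" "0 < s"
  shows "radial (\<lambda>x. \<phi> (s *\<^sub>R x))"
proof -
  obtain \<psi> where \<psi>: "even_test_function \<psi>" "\<phi> = (\<lambda>x. \<psi> (norm x))" using assms radial_iff by blast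
  have "even_test_function (\<lambda>r. \<psi> (s * r))"
    using \<psi>(1) test_function_dilation[of \<psi> s 0] assms(2) by (simp add: even_test_function_def)
  from radialI[OF this, where 'a = 'a] show ?thesis
    using \<psi>(2) assms(2) by simp
qed

text \<open>For each \<open>s > 0\<close> the hypothesis is applied to a dilate of
  \<open>\<phi>\<close> whose delta sequence at index \<open>n\<close> is \<open>\<phi>\<close>
  dilated by \<open>n * s\<close>; \<open>tendsto_at_top_if_tendsto_multiples\<close> then passes to
  the real parameter.\<close>

lemma radial_limit_positive_normalized:
  fixes f :: "('a::euclidean_space \<Rightarrow> complex) \<Rightarrow> complex"
  assumes f: "distribution f"
    and lim: "\<And>\<phi>. test_function \<phi> \<Longrightarrow> positive_fun \<phi> \<Longrightarrow> normalized \<phi> \<Longrightarrow> radial \<phi> \<Longrightarrow>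
      (\<lambda>n. affine_change f x0 1 (standard_delta_sequence \<phi> n)) \<longlonglongrightarrow> \<gamma>"
    and \<phi>: "positive_fun \<phi>" "normalized \<phi>" "radial \<phi>"
  shows "radial_limit f x0 \<gamma> \<phi>"
proof -
  have t: "test_function \<phi>" using \<phi>(3) by (rule test_function_radial)
  have "(\<lambda>n. dilated_pairing f x0 \<phi> (real n * s)) \<longlonglongrightarrow> \<gamma>" if s: "0 < s" for s
  proof -
    \<comment> \<open>The factor \<open>s ^ DIM('a)\<close> compensates the change of volume and
      keeps the integral equal to 1.\<close>
    let ?\<phi> = "\<lambda>x. of_real (s ^ DIM('a)) * \<phi> (s *\<^sub>R x)"
    have r: "radial ?\<phi>" using \<phi>(3) s by (intro radial_cmult radial_dilation)
    have t': "test_function (\<lambda>x. \<phi> (s *\<^sub>R x))" using \<phi>(3) s by (intro test_function_radial radial_dilation)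
    have "positive_fun ?\<phi>"
      using \<phi>(1) s unfolding positive_fun_def by (auto intro!: nonneg_Reals_mult_I)
    moreover have "normalized ?\<phi>"
      using \<phi>(2) s unfolding normalized_def
      by (subst (asm) integral_lborel_scaleR[of _ s])
        (auto simp: test_function_borel_measurable[OF t] scaleR_conv_of_real)
    ultimately have "(\<lambda>n. affine_change f x0 1 (standard_delta_sequence ?\<phi> n)) \<longlonglongrightarrow> \<gamma>"
      using lim r test_function_radial[OF r] by blast
    then show ?thesis
    proof (rule Lim_transform_eventually)
      show "\<forall>\<^sub>F n in sequentially. affine_change f x0 1 (standard_delta_sequence ?\<phi> n) =
          dilated_pairing f x0 \<phi> (real n * s)"
        using eventually_gt_at_top[of 0]
      proof eventually_elim
        case (elim n)
        have "affine_change f x0 1 (standard_delta_sequence ?\<phi> n) = dilated_pairing f x0 ?\<phi> (real n)"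
          by (rule affine_change_standard_delta_sequence[OF f test_function_radial[OF r] elim])
        also have "\<dots> = of_real (s ^ DIM('a)) * dilated_pairing f x0 (\<lambda>x. \<phi> (s *\<^sub>R x)) (real n)"
          using elim by (intro dilated_pairing_cmult[OF f t']) simp
        also have "\<dots> = dilated_pairing f x0 \<phi> (real n * s)"
          by (simp add: dilated_pairing_def power_mult_distrib mult_ac)
        finally show ?case .
      qed
    qed
  qed
  then have "(dilated_pairing f x0 \<phi> \<longlongrightarrow> \<gamma>) at_top"
    by (intro tendsto_at_top_if_tendsto_multiples continuous_on_dilated_pairing f t)
  then show ?thesis
    using \<phi> by (simp add: radial_limit_def normalized_def)
qed

text \<open>Division by the integral reduces to the normalized case, and multiplication by it leads
  back.\<close>

lemma radial_limit_nonneg: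
  fixes f :: "('a::euclidean_space \<Rightarrow> complex) \<Rightarrow> complex"
  assumes f: "distribution f"
    and lim: "\<And>\<phi>. positive_fun \<phi> \<Longrightarrow> normalized \<phi> \<Longrightarrow> radial \<phi> \<Longrightarrow> radial_limit f x0 \<gamma> \<phi>"
    and q: "radial (\<lambda>x. complex_of_real (q x))" "\<And>x. 0 \<le> q x" "0 < (LINT x|lborel. q x)"
  shows "radial_limit f x0 \<gamma> (\<lambda>x. complex_of_real (q x))"
proof -
  define I where "I = (LINT x|lborel. q x)"
  let ?\<phi> = "\<lambda>x. complex_of_real (1 / I) * complex_of_real (q x)"
  have "0 < I" using q(3) by (simp add: I_def)
  have "radial_limit f x0 \<gamma> ?\<phi>"
  proof (rule lim)
    show "positive_fun ?\<phi>"
      using q(2) \<open>0 < I\<close> by (simp add: positive_fun_def flip: of_real_divide)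
    show "normalized ?\<phi>"
      using \<open>0 < I\<close> by (simp add: normalized_def I_def)
    show "radial ?\<phi>" using q(1) by (rule radial_cmult)
  qed
  from radial_limit_cmult[OF f this, of "complex_of_real I"]
  show ?thesis using \<open>0 < I\<close> by simp
qed

text \<open>If the integral were 0, then \<open>q\<close> would vanish almost everywhere and the
  ball would be a null set.\<close>

lemma integral_pos_if_pos_on_ball:
  fixes q :: "'a::euclidean_space \<Rightarrow> real"
  assumes "integrable lborel q" "\<And>x. 0 \<le> q x" "0 < r" "\<And>x. norm x < r \<Longrightarrow> 0 < q x"
  shows "0 < (LINT x|lborel. q x)"
proof -
  have "(LINT x|lborel. q x) \<noteq> 0"
  proof
    assume "(LINT x|lborel. q x) = 0"
    then have "AE x in lborel. q x = 0"
      using assms by (simp add: integral_nonneg_eq_0_iff_AE)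
    then have "AE x in lborel. x \<notin> ball (0 :: 'a) r"
      by (rule eventually_mono) (use assms(4) in force)
    then have "ball (0 :: 'a) r \<in> null_sets lborel"
      by (subst AE_iff_null_sets) auto
    then show False
      using content_ball_pos[OF assms(3), of "0 :: 'a"] by (simp add: measure_def null_sets_def)
  qed
  moreover have "0 \<le> (LINT x|lborel. q x)" using assms(2) by (simp add: integral_nonneg)
  ultimately show ?thesis by simp
qed

text \<open>A bump of radius \<open>R + 1\<close> stays away from 0 on \<open>[-R, R]\<close>, which
  contains the support of \<open>q\<close>: there \<open>(R + 1)\<^sup>2 - r\<^sup>2\<close> is at
  least \<open>2 * R + 1\<close>.\<close>

lemma real_test_function_dominated_by_bump:
  assumes "test_function (\<lambda>r. complex_of_real (q r))"
  obtains R C where "0 < R" "0 \<le> C" "\<And>r. - q r \<le> C * flat_exp 0 (R\<^sup>2 - r\<^sup>2)"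
proof -
  obtain R where R: "0 < R" "\<And>r. R < norm r \<Longrightarrow> complex_of_real (q r) = 0"
    using test_functionE[OF assms] by blast
  obtain B where B: "0 < B" "\<And>r. norm (complex_of_real (q r)) \<le> B"
    using test_function_bounded[OF assms] by blast
  let ?b = "\<lambda>r. flat_exp 0 ((R + 1)\<^sup>2 - r\<^sup>2)"
  have pos: "exp (- (1 / (2 * R + 1))) \<le> ?b r" if "\<bar>r\<bar> \<le> R" for r
  proof -
    have "r\<^sup>2 \<le> R\<^sup>2" using that by (simp add: abs_le_square_iff[symmetric])
    then have *: "2 * R + 1 \<le> (R + 1)\<^sup>2 - r\<^sup>2" by (simp add: power2_eq_square algebra_simps)
    then have "1 / ((R + 1)\<^sup>2 - r\<^sup>2) \<le> 1 / (2 * R + 1)" using R(1) by (intro divide_left_mono) auto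
    then show ?thesis using * R(1) by (simp add: flat_exp_def)
  qed
  \<comment> \<open>Chosen so that \<open>C\<close> times the lower bound in \<open>pos\<close> is
    exactly \<open>B\<close>.\<close>
  define C where "C = B * exp (1 / (2 * R + 1))"
  have "- q r \<le> C * ?b r" for r
  proof (cases "\<bar>r\<bar> \<le> R")
    case True
    have "- q r \<le> B" using B(2)[of r] by simp
    also have "\<dots> = C * exp (- (1 / (2 * R + 1)))" by (simp add: C_def exp_minus)
    also have "\<dots> \<le> C * ?b r" using pos[OF True] B(1) by (intro mult_left_mono) (auto simp: C_def)
    finally show ?thesis .
  next
    case False
    then show ?thesis using R B(1) by (simp add: C_def flat_exp_def)
  qed
  then show ?thesis using that[of "R + 1" C] R(1) B(1) by (simp add: C_def)
qed

text \<open>The function is the difference of \<open>(C + 1) * b + q\<close> and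
  \<open>(C + 1) * b\<close>, both covered by the nonnegative case and linearity.\<close>

lemma radial_limit_of_real:
  fixes f :: "('a::euclidean_space \<Rightarrow> complex) \<Rightarrow> complex"
  assumes f: "distribution f"
    and lim: "\<And>\<phi>. positive_fun \<phi> \<Longrightarrow> normalized \<phi> \<Longrightarrow> radial \<phi> \<Longrightarrow> radial_limit f x0 \<gamma> \<phi>"
    and q: "even_test_function (\<lambda>r. complex_of_real (q r))"
  shows "radial_limit f x0 \<gamma> (\<lambda>x. complex_of_real (q (norm x)))"
proof -
  obtain R C where C: "0 < R" "0 \<le> C" "\<And>r. - q r \<le> C * flat_exp 0 (R\<^sup>2 - r\<^sup>2)"
    using real_test_function_dominated_by_bump[of q] q by (auto simp: even_test_function_def)
  define b where "b = (\<lambda>x::'a. flat_exp 0 (R\<^sup>2 - (norm x)\<^sup>2))"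
  have b: "radial (\<lambda>x. complex_of_real (b x))"
    unfolding b_def by (rule radialI[OF even_test_function_bump])
  have b0: "0 \<le> b x" for x by (simp add: b_def flat_exp_def)
  have bint: "integrable lborel b"
    using test_function_integrable[OF test_function_radial[OF b]] integrable_Re by fastforce
  have bpos: "0 < (LINT x|lborel. b x)"
  proof (rule integral_pos_if_pos_on_ball[OF bint b0 C(1)])
    fix x :: 'a assume "norm x < R"
    then have "(norm x)\<^sup>2 < R\<^sup>2" by (intro power_strict_mono) auto
    then show "0 < b x" by (simp add: b_def flat_exp_def)
  qed
  have Q: "radial (\<lambda>x::'a. complex_of_real (q (norm x)))"
    by (rule radialI[OF q])
  have qint: "integrable lborel (\<lambda>x::'a. q (norm x))"
    using test_function_integrable[OF test_function_radial[OF Q]] integrable_Re by fastforce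
  \<comment> \<open>\<open>C * b\<close> already makes the sum nonnegative; the extra
    \<open>b\<close> bounds it below by \<open>b\<close> and so makes its integral positive.\<close>
  let ?s = "\<lambda>x. (C + 1) * b x + q (norm x)"
  have s0: "b x \<le> ?s x" for x
    using C(3)[of "norm x"] by (simp add: b_def algebra_simps)
  have "radial_limit f x0 \<gamma> (\<lambda>x. complex_of_real (?s x))"
  proof (rule radial_limit_nonneg[OF f lim])
    show "radial (\<lambda>x. complex_of_real (?s x))"
      using radial_add[OF radial_cmult[OF b, of "complex_of_real (C + 1)"] Q] by simp
    show "0 \<le> ?s x" for x using b0[of x] s0[of x] by linarith
    have "(LINT x|lborel. b x) \<le> (LINT x|lborel. ?s x)"
      using bint qint s0 by (intro integral_mono) auto
    then show "0 < (LINT x|lborel. ?s x)" using bpos by linarith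
  qed
  moreover have "radial_limit f x0 \<gamma> (\<lambda>x. complex_of_real (b x))"
    by (rule radial_limit_nonneg[OF f lim b b0 bpos])
  ultimately have "radial_limit f x0 \<gamma>
      (\<lambda>x. complex_of_real (?s x) + complex_of_real (- (C + 1)) * complex_of_real (b x))"
    by (intro radial_limit_add radial_limit_cmult f)
  moreover have "(\<lambda>x. complex_of_real (?s x) + complex_of_real (- (C + 1)) * complex_of_real (b x)) =
      (\<lambda>x. complex_of_real (q (norm x)))"
    by (simp add: fun_eq_iff algebra_simps)
  ultimately show ?thesis by (simp only:)
qed

text \<open>The real and imaginary parts of the profile are again even test functions, and complex
  linearity reassembles them.\<close>

lemma radial_limit_if_positive_normalized:
  fixes f :: "('a::euclidean_space \<Rightarrow> complex) \<Rightarrow> complex"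
  assumes f: "distribution f"
    and lim: "\<And>\<phi>. positive_fun \<phi> \<Longrightarrow> normalized \<phi> \<Longrightarrow> radial \<phi> \<Longrightarrow> radial_limit f x0 \<gamma> \<phi>"
    and "radial \<phi>"
  shows "radial_limit f x0 \<gamma> \<phi>"
proof -
  obtain \<psi> where \<psi>: "even_test_function \<psi>" "\<phi> = (\<lambda>x. \<psi> (norm x))" using assms radial_iff by blast
  have real_part: "even_test_function (\<lambda>r. complex_of_real (L (\<psi> r)))" if L: "bounded_linear L" for L
    using \<psi>(1) test_function_bounded_linear[of \<psi>, OF _ bounded_linear_compose[OF bounded_linear_of_real L]]
    by (simp add: even_test_function_def)
  have "radial_limit f x0 \<gamma> (\<lambda>x. complex_of_real (Re (\<psi> (norm x))) + \<i> * complex_of_real (Im (\<psi> (norm x))))"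
    by (intro radial_limit_add radial_limit_cmult radial_limit_of_real f lim real_part
        bounded_linear_Re bounded_linear_Im)
  then show ?thesis by (simp add: \<psi>(2) flip: complex_eq)
qed

theorem proposition7p7:
  fixes f :: "(real ^ 'd \<Rightarrow> complex) \<Rightarrow> complex"
    and x0 :: "real ^ 'd" and \<gamma> :: complex
  assumes "distribution f"
  shows "(\<forall>\<phi>. test_function \<phi> \<and> positive_fun \<phi> \<and> normalized \<phi> \<and> radial \<phi> \<longrightarrow>
            (\<lambda>n. affine_change f x0 1 (standard_delta_sequence \<phi> n)) \<longlonglongrightarrow> \<gamma>)
         \<longleftrightarrow> has_radial_point_value f x0 \<gamma>"
proof
  assume *: "\<forall>\<phi>. test_function \<phi> \<and> positive_fun \<phi> \<and> normalized \<phi> \<and> radial \<phi> \<longrightarrow>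
    (\<lambda>n. affine_change f x0 1 (standard_delta_sequence \<phi> n)) \<longlonglongrightarrow> \<gamma>"
  show "has_radial_point_value f x0 \<gamma>"
    unfolding has_radial_point_value_def has_point_value_at_0_def
  proof (intro allI impI)
    fix \<phi> :: "real ^ 'd \<Rightarrow> complex" assume \<phi>: "test_function \<phi>"
    have "radial_limit f x0 \<gamma> (radial_component_fun \<phi>)"
    proof (rule radial_limit_if_positive_normalized[OF assms _ radial_radial_component_fun[OF \<phi>]])
      fix \<eta> :: "real ^ 'd \<Rightarrow> complex" assume "positive_fun \<eta>" "normalized \<eta>" "radial \<eta>"
      then show "radial_limit f x0 \<gamma> \<eta>"
        by (rule radial_limit_positive_normalized[OF assms, rotated]) (use * in simp)
    qed
    \<comment> \<open>The integral of the radial component is replaced by that of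
      \<open>\<phi>\<close>.\<close>
    then have lim: "(dilated_pairing f x0 (radial_component_fun \<phi>) \<longlongrightarrow> \<gamma> * (LINT x|lborel. \<phi> x)) at_top"
      by (simp add: radial_limit_def integral_radial_component_fun[OF test_function_integrable[OF \<phi>]])
    have "((\<lambda>\<epsilon>. \<bar>\<epsilon>\<bar>) \<longlongrightarrow> \<bar>0 :: real\<bar>) (at 0)" by (intro tendsto_intros)
    then have "filterlim (\<lambda>\<epsilon>::real. inverse \<bar>\<epsilon>\<bar>) at_top (at 0)"
      by (intro filterlim_inverse_at_top) (auto simp: eventually_at_filter)
    from filterlim_compose[OF lim this]
    show "((\<lambda>\<epsilon>. affine_change (radial_component (affine_change f x0 1)) 0 \<epsilon> \<phi>) \<longlongrightarrow>
        \<gamma> * (LINT x|lborel. \<phi> x)) (at 0)"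
      by (simp add: affine_change_radial_component[OF \<phi>])
  qed
next
  assume *: "has_radial_point_value f x0 \<gamma>"
  show "\<forall>\<phi>. test_function \<phi> \<and> positive_fun \<phi> \<and> normalized \<phi> \<and> radial \<phi> \<longrightarrow>
    (\<lambda>n. affine_change f x0 1 (standard_delta_sequence \<phi> n)) \<longlonglongrightarrow> \<gamma>"
  proof (intro allI impI, elim conjE)
    fix \<phi> :: "real ^ 'd \<Rightarrow> complex"
    assume \<phi>: "test_function \<phi>" "normalized \<phi>" "radial \<phi>"
    have "((\<lambda>\<epsilon>. affine_change (radial_component (affine_change f x0 1)) 0 \<epsilon> \<phi>) \<longlongrightarrow> \<gamma>) (at 0)"
      using * \<phi>(1,2)
      unfolding has_radial_point_value_def has_point_value_at_0_def normalized_def by fastforce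
    then have "((\<lambda>\<epsilon>. dilated_pairing f x0 \<phi> (inverse \<bar>\<epsilon>\<bar>)) \<longlongrightarrow> \<gamma>) (at 0)"
      \<comment> \<open>A radial function is its own radial component.\<close>
      by (simp add: affine_change_radial_component[OF \<phi>(1)] radial_component_fun_radial[OF \<phi>(3)])
    \<comment> \<open>The limit at 0 is restricted to \<open>\<epsilon> = 1 / n\<close>, which
      recovers the integer parameters of the delta sequence.\<close>
    moreover have "filterlim (\<lambda>n. inverse (real n)) (at 0) sequentially"
      unfolding filterlim_at
      using lim_inverse_n eventually_gt_at_top[of 0] by (auto elim!: eventually_mono)
    ultimately have "(\<lambda>n. dilated_pairing f x0 \<phi> (inverse \<bar>inverse (real n)\<bar>)) \<longlonglongrightarrow> \<gamma>"
      by (rule filterlim_compose)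
    then show "(\<lambda>n. affine_change f x0 1 (standard_delta_sequence \<phi> n)) \<longlonglongrightarrow> \<gamma>"
      by (rule Lim_transform_eventually)
        (use eventually_gt_at_top[of 0] in \<open>eventually_elim, simp add: affine_change_standard_delta_sequence[OF assms \<phi>(1)]\<close>)
  qed
qed

end
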